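(* Let $\Sigma$ be a simplicial complex on the finite vertex set $V$ with $n=\#V$, let $d=\dim(\Sigma)$, and let $k,\ell$ be integers with $d\ge\ell\ge k+1\ge1$. Assume $n\ge d+3$ and \[\mu_\ell^H> n\left(1-\prod_{i=0}^{\ell-k-1}\frac{d_{k+i}}{n-k-i-2}\right),\] where $\mu_\ell^H=\min\sigma(\Delta_\ell^H)$ and $d_j=\min_{\tau\in\Sigma_j}\#\{\sigma\in\Sigma_{j+1}\mid\tau\prec\sigma\}$. Then $H^k(\Sigma,\mathbb R)=\{0\}$.
   Context: A simplicial complex on a finite set $V$ is a family $\Sigma\subseteq\mathcal P(V)$ closed under taking subsets. $\Sigma_k$ is the set of $\sigma\in\Sigma$ with $\#\sigma=k+1$ (so $\Sigma_{-1}=\{\emptyset\}$ for nonempty $\Sigma$), and $\dim(\Sigma)=\max\{k\mid\Sigma_k\ne\emptyset\}$. Write $\tau\prec\sigma$ if $\tau\subseteq\sigma$ and $\#(\sigma\setminus\tau)=1$. $\mathcal K=\mathcal P(V)$ is the complete complex, $\mathcal K_k$ its simplices of cardinality $k+1$. $\ell^2(\Sigma_k)$ is the space of real valued functions on $\Sigma_k$ with $\langle\phi,\psi\rangle=\sum_{\tau\in\Sigma_k}\phi(\tau)\psi(\tau)$. Coboundary operators are linear maps $\delta_k:\ell^2(\Sigma_k)\to\ell^2(\Sigma_{k+1})$, $k\ge-1$, with $\delta_{k+1}\delta_k=0$ and $\delta_k1_\tau(\sigma)\in\{\pm1,0\}$, nonzero iff $\tau\prec\sigma$. They are chosen as follows: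 fix coboundary operators $\widehat\delta_k$ for $\mathcal K$ and put $\delta_k=\pi_{k+1}\widehat\delta_k\iota_k$, where $\iota_k:\ell^2(\Sigma_k)\to\ell^2(\mathcal K_k)$ is extension by zero and $\pi_k:\ell^2(\mathcal K_k)\to\ell^2(\Sigma_k)$ is restriction. (The usual oriented simplicial coboundary of the augmented cochain complex is an example; the spectra below do not depend on the choice.) Let $\partial_k=\delta_k^*$ be the adjoint and $\Delta_k^H=\partial_k\delta_k+\delta_{k-1}\partial_{k-1}$ on $\ell^2(\Sigma_k)$, $k\ge0$. $\sigma(A)$ denotes the spectrum of an operator $A$. The $k$-th reduced cohomology group is $H^k(\Sigma,\mathbb R)=\ker\delta_k/\mathrm{ran}\,\delta_{k-1}$, $k\ge0$. *)

theory Defs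
  imports Complex_Main "HOL-Library.Indicator_Function" "HOL-Algebra.Coset"
begin

definition abstract_complex :: "'a set \<Rightarrow> 'a set set \<Rightarrow> bool" where
  "abstract_complex V \<Sigma> \<longleftrightarrow> \<Sigma> \<subseteq> Pow V \<and> (\<forall>\<sigma>\<in>\<Sigma>. \<forall>\<tau>. \<tau> \<subseteq> \<sigma> \<longrightarrow> \<tau> \<in> \<Sigma>)"

(* The dimension index is an integer, so that the empty face (index -1) is covered. *)
definition faces :: "'a set set \<Rightarrow> int \<Rightarrow> 'a set set" where
  "faces \<Sigma> k = {\<sigma> \<in> \<Sigma>. int (card \<sigma>) = k + 1}"

definition cdim :: "'a set set \<Rightarrow> int" where
  "cdim \<Sigma> = Max {k. faces \<Sigma> k \<noteq> {}}"

definition facet_of :: "'a set \<Rightarrow> 'a set \<Rightarrow> bool"  (infix "\<prec>f" 50) where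
  "\<tau> \<prec>f \<sigma> \<longleftrightarrow> \<tau> \<subseteq> \<sigma> \<and> card (\<sigma> - \<tau>) = 1"

definition min_degree :: "'a set set \<Rightarrow> int \<Rightarrow> nat" where
  "min_degree \<Sigma> j = Min ((\<lambda>\<tau>. card {\<sigma> \<in> faces \<Sigma> (j + 1). \<tau> \<prec>f \<sigma>}) ` faces \<Sigma> j)"

(* Real functions on a (finite) set S are represented by total functions vanishing off S.
   An operator on ell2 S is a total function whose values off ell2 S are irrelevant. *)
definition ell2 :: "'b set \<Rightarrow> ('b \<Rightarrow> real) set" where
  "ell2 S = {\<phi>. \<forall>x. x \<notin> S \<longrightarrow> \<phi> x = 0}"

definition ell2_inner :: "'b set \<Rightarrow> ('b \<Rightarrow> real) \<Rightarrow> ('b \<Rightarrow> real) \<Rightarrow> real" where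
  "ell2_inner S \<phi> \<psi> = (\<Sum>x\<in>S. \<phi> x * \<psi> x)"

definition ell2_linear ::
  "'b set \<Rightarrow> 'c set \<Rightarrow> (('b \<Rightarrow> real) \<Rightarrow> ('c \<Rightarrow> real)) \<Rightarrow> bool" where
  "ell2_linear S T A \<longleftrightarrow>
     (\<forall>\<phi>\<in>ell2 S. A \<phi> \<in> ell2 T) \<and>
     (\<forall>\<phi>\<in>ell2 S. \<forall>\<psi>\<in>ell2 S. A (\<lambda>x. \<phi> x + \<psi> x) = (\<lambda>y. A \<phi> y + A \<psi> y)) \<and>
     (\<forall>c. \<forall>\<phi>\<in>ell2 S. A (\<lambda>x. c * \<phi> x) = (\<lambda>y. c * A \<phi> y))"

(* For finite S, T and A linear from ell2 S to ell2 T, the element \<phi> below exists and is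
   unique for every \<psi> in ell2 T. *)
definition ell2_adjoint ::
  "'b set \<Rightarrow> 'c set \<Rightarrow> (('b \<Rightarrow> real) \<Rightarrow> ('c \<Rightarrow> real)) \<Rightarrow> (('c \<Rightarrow> real) \<Rightarrow> ('b \<Rightarrow> real))" where
  "ell2_adjoint S T A \<psi> =
     (THE \<phi>. \<phi> \<in> ell2 S \<and> (\<forall>\<eta>\<in>ell2 S. ell2_inner T (A \<eta>) \<psi> = ell2_inner S \<eta> \<phi>))"

(* Real spectrum; it is applied only to self-adjoint operators, whose spectrum is real. *)
definition ell2_spectrum :: "'b set \<Rightarrow> (('b \<Rightarrow> real) \<Rightarrow> ('b \<Rightarrow> real)) \<Rightarrow> real set" where
  "ell2_spectrum S A = {c. \<not> bij_betw (\<lambda>\<phi> x. A \<phi> x - c * \<phi> x) (ell2 S) (ell2 S)}"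

definition coboundary_operators ::
  "'a set set \<Rightarrow> (int \<Rightarrow> ('a set \<Rightarrow> real) \<Rightarrow> ('a set \<Rightarrow> real)) \<Rightarrow> bool" where
  "coboundary_operators \<Sigma> \<delta> \<longleftrightarrow>
     (\<forall>k\<ge>-1.
        ell2_linear (faces \<Sigma> k) (faces \<Sigma> (k + 1)) (\<delta> k) \<and>
        (\<forall>\<phi>\<in>ell2 (faces \<Sigma> k). \<delta> (k + 1) (\<delta> k \<phi>) = (\<lambda>_. 0)) \<and>
        (\<forall>\<tau>\<in>faces \<Sigma> k. \<forall>\<sigma>\<in>faces \<Sigma> (k + 1).
           \<delta> k (indicator {\<tau>}) \<sigma> \<in> {1, -1, 0} \<and>
           (\<delta> k (indicator {\<tau>}) \<sigma> \<noteq> 0 \<longleftrightarrow> \<tau> \<prec>f \<sigma>)))"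

(* The operator \<pi> \<circ> \<delta>' \<circ> \<iota>, where \<delta>' are coboundary operators of the complete complex:
   in the present representation the extension by zero \<iota> is the inclusion, and the
   restriction \<pi> sets a function to zero off the faces of \<Sigma>. *)
definition cobd ::
  "(int \<Rightarrow> ('a set \<Rightarrow> real) \<Rightarrow> ('a set \<Rightarrow> real)) \<Rightarrow> 'a set set \<Rightarrow>
     int \<Rightarrow> ('a set \<Rightarrow> real) \<Rightarrow> ('a set \<Rightarrow> real)" where
  "cobd \<delta>' \<Sigma> k \<phi> = (\<lambda>\<sigma>. if \<sigma> \<in> faces \<Sigma> (k + 1) then \<delta>' k \<phi> \<sigma> else 0)"

definition bd ::
  "(int \<Rightarrow> ('a set \<Rightarrow> real) \<Rightarrow> ('a set \<Rightarrow> real)) \<Rightarrow> 'a set set \<Rightarrow>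
     int \<Rightarrow> ('a set \<Rightarrow> real) \<Rightarrow> ('a set \<Rightarrow> real)" where
  "bd \<delta>' \<Sigma> k = ell2_adjoint (faces \<Sigma> k) (faces \<Sigma> (k + 1)) (cobd \<delta>' \<Sigma> k)"

definition hodge_laplacian ::
  "(int \<Rightarrow> ('a set \<Rightarrow> real) \<Rightarrow> ('a set \<Rightarrow> real)) \<Rightarrow> 'a set set \<Rightarrow>
     int \<Rightarrow> ('a set \<Rightarrow> real) \<Rightarrow> ('a set \<Rightarrow> real)" where
  "hodge_laplacian \<delta>' \<Sigma> k \<phi> =
     (\<lambda>\<tau>. bd \<delta>' \<Sigma> k (cobd \<delta>' \<Sigma> k \<phi>) \<tau> + cobd \<delta>' \<Sigma> (k - 1) (bd \<delta>' \<Sigma> (k - 1) \<phi>) \<tau>)"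

definition hodge_min ::
  "(int \<Rightarrow> ('a set \<Rightarrow> real) \<Rightarrow> ('a set \<Rightarrow> real)) \<Rightarrow> 'a set set \<Rightarrow> int \<Rightarrow> real" where
  "hodge_min \<delta>' \<Sigma> k = Min (ell2_spectrum (faces \<Sigma> k) (hodge_laplacian \<delta>' \<Sigma> k))"

definition cocycles ::
  "(int \<Rightarrow> ('a set \<Rightarrow> real) \<Rightarrow> ('a set \<Rightarrow> real)) \<Rightarrow> 'a set set \<Rightarrow> int \<Rightarrow>
     ('a set \<Rightarrow> real) monoid" where
  "cocycles \<delta>' \<Sigma> k =
     \<lparr>carrier = {\<phi> \<in> ell2 (faces \<Sigma> k). cobd \<delta>' \<Sigma> k \<phi> = (\<lambda>_. 0)},
      mult = (\<lambda>\<phi> \<psi> \<tau>. \<phi> \<tau> + \<psi> \<tau>),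
      one = (\<lambda>_. 0)\<rparr>"

definition cohomology ::
  "(int \<Rightarrow> ('a set \<Rightarrow> real) \<Rightarrow> ('a set \<Rightarrow> real)) \<Rightarrow> 'a set set \<Rightarrow> int \<Rightarrow>
     ('a set \<Rightarrow> real) set monoid" where
  "cohomology \<delta>' \<Sigma> k = cocycles \<delta>' \<Sigma> k Mod (cobd \<delta>' \<Sigma> (k - 1) ` ell2 (faces \<Sigma> (k - 1)))"

end

theory Submission
  imports Defs "HOL-Analysis.Function_Topology" "HOL-Analysis.Convex"
begin

text \<open>On the complete complex the Hodge Laplacian is \<open>n\<close> times the identity. Hence, for \<open>\<phi>\<close> on the
  \<open>k\<close>-faces of \<open>\<Sigma>\<close>, the energy \<open>\<langle>\<phi>, \<Delta>\<^sub>k \<phi>\<rangle>\<close> is \<open>n \<parallel>\<phi>\<parallel>\<^sup>2\<close> minus the squared norm of the coboundary of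
  \<open>\<phi>\<close> on the \<open>(k+1)\<close>-simplices that are not in \<open>\<Sigma>\<close>. Let \<open>\<lambda>\<^sub>k\<close> be the squared operator norm of this
  map from faces to non-faces, so that \<open>\<lambda>\<^sub>l = n - \<mu>\<^sub>l\<close>, and so that there are no harmonic functions
  in degree \<open>k\<close> if \<open>\<lambda>\<^sub>k < n\<close>. The adjoint sends \<open>\<eta>\<close> on non-faces to its boundary on the faces.
  Testing the adjoint in degree \<open>k+1\<close> on the exterior products of \<open>\<eta>\<close> with all vertices
  and summing gives \<open>d\<^sub>k \<lambda>\<^sub>k \<le> (n - k - 2) \<lambda>\<^sub>k\<^sub>+\<^sub>1\<close>, and iterating from \<open>k\<close> to \<open>l\<close>
  gives \<open>\<lambda>\<^sub>k < n\<close>.\<close>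

section \<open>Symmetric operators on a finite-dimensional function space\<close>

lemma ell2_indicator: "x \<in> S \<Longrightarrow> indicator {x} \<in> ell2 S"
  by (auto simp: ell2_def indicator_def)

lemma ell2_add: "\<phi> \<in> ell2 S \<Longrightarrow> \<psi> \<in> ell2 S \<Longrightarrow> (\<lambda>x. \<phi> x + \<psi> x) \<in> ell2 S"
  by (auto simp: ell2_def)

lemma ell2_diff: "\<phi> \<in> ell2 S \<Longrightarrow> \<psi> \<in> ell2 S \<Longrightarrow> (\<lambda>x. \<phi> x - \<psi> x) \<in> ell2 S"
  by (auto simp: ell2_def)

lemma ell2_scale: "\<phi> \<in> ell2 S \<Longrightarrow> (\<lambda>x. c * \<phi> x) \<in> ell2 S"
  by (auto simp: ell2_def)

lemma ell2_sum: "(\<And>u. u \<in> U \<Longrightarrow> f u \<in> ell2 S) \<Longrightarrow> (\<lambda>x. \<Sum>u\<in>U. f u x) \<in> ell2 S"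
  by (auto simp: ell2_def intro!: sum.neutral)

lemma ell2_zero: "(\<lambda>_. 0) \<in> ell2 S"
  by (simp add: ell2_def)

lemma ell2_inner_commute: "ell2_inner S \<phi> \<psi> = ell2_inner S \<psi> \<phi>"
  by (simp add: ell2_inner_def mult.commute)

lemma ell2_inner_add_left:
  "ell2_inner S (\<lambda>x. \<phi> x + \<psi> x) \<eta> = ell2_inner S \<phi> \<eta> + ell2_inner S \<psi> \<eta>"
  by (simp add: ell2_inner_def sum.distrib algebra_simps)

lemma ell2_inner_add_right:
  "ell2_inner S \<eta> (\<lambda>x. \<phi> x + \<psi> x) = ell2_inner S \<eta> \<phi> + ell2_inner S \<eta> \<psi>"
  by (simp add: ell2_inner_def sum.distrib algebra_simps)

lemma ell2_inner_diff_left: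
  "ell2_inner S (\<lambda>x. \<phi> x - \<psi> x) \<eta> = ell2_inner S \<phi> \<eta> - ell2_inner S \<psi> \<eta>"
  by (simp add: ell2_inner_def sum_subtractf algebra_simps)

lemma ell2_inner_diff_right:
  "ell2_inner S \<eta> (\<lambda>x. \<phi> x - \<psi> x) = ell2_inner S \<eta> \<phi> - ell2_inner S \<eta> \<psi>"
  by (simp add: ell2_inner_def sum_subtractf algebra_simps)

lemma ell2_inner_scale_left: "ell2_inner S (\<lambda>x. c * \<phi> x) \<eta> = c * ell2_inner S \<phi> \<eta>"
  by (simp add: ell2_inner_def sum_distrib_left algebra_simps)

lemma ell2_inner_scale_right: "ell2_inner S \<eta> (\<lambda>x. c * \<phi> x) = c * ell2_inner S \<eta> \<phi>"
  by (simp add: ell2_inner_def sum_distrib_left algebra_simps)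

lemma ell2_inner_sum_left:
  "ell2_inner S (\<lambda>x. \<Sum>u\<in>U. f u x) \<eta> = (\<Sum>u\<in>U. ell2_inner S (f u) \<eta>)"
  unfolding ell2_inner_def sum_distrib_right by (rule sum.swap)

lemmas ell2_inner_simps =
  ell2_inner_add_left ell2_inner_add_right ell2_inner_diff_left ell2_inner_diff_right
  ell2_inner_scale_left ell2_inner_scale_right

lemma ell2_inner_ge_0: "ell2_inner S \<phi> \<phi> \<ge> 0"
  by (simp add: ell2_inner_def sum_nonneg)

lemma ell2_inner_eq_0:
  assumes "finite S" "\<phi> \<in> ell2 S"
  shows "ell2_inner S \<phi> \<phi> = 0 \<longleftrightarrow> \<phi> = (\<lambda>_. 0)"
proof -
  have "ell2_inner S \<phi> \<phi> = 0 \<longleftrightarrow> (\<forall>x\<in>S. \<phi> x * \<phi> x = 0)"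
    unfolding ell2_inner_def by (rule sum_nonneg_eq_0_iff) (auto simp: assms)
  then show ?thesis using assms(2) by (auto simp: ell2_def fun_eq_iff)
qed

lemma ell2_inner_indicator:
  assumes "finite S" "x \<in> S"
  shows "ell2_inner S (indicator {x}) \<phi> = \<phi> x"
  using assms by (simp add: ell2_inner_def indicator_def if_distrib[of "\<lambda>t. t * _"] cong: if_cong)

lemma ell2_linear_zero: "ell2_linear S T A \<Longrightarrow> A (\<lambda>_. 0) = (\<lambda>_. 0)"
proof -
  assume "ell2_linear S T A"
  then have "\<forall>c. \<forall>\<phi>\<in>ell2 S. A (\<lambda>x. c * \<phi> x) = (\<lambda>y. c * A \<phi> y)"
    by (simp add: ell2_linear_def)
  from this[rule_format, OF ell2_zero, of 0] show ?thesis by simp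
qed

lemma ell2_linear_sum:
  assumes A: "ell2_linear S T A" and "finite U" and "\<And>u. u \<in> U \<Longrightarrow> f u \<in> ell2 S"
  shows "A (\<lambda>x. \<Sum>u\<in>U. f u x) = (\<lambda>y. \<Sum>u\<in>U. A (f u) y)"
  using assms(2,3)
proof (induction U)
  case empty
  then show ?case using ell2_linear_zero[OF A] by simp
next
  case (insert u U)
  have add: "\<forall>\<phi>\<in>ell2 S. \<forall>\<psi>\<in>ell2 S. A (\<lambda>x. \<phi> x + \<psi> x) = (\<lambda>y. A \<phi> y + A \<psi> y)"
    using A by (simp add: ell2_linear_def)
  have "f u \<in> ell2 S" "(\<lambda>x. \<Sum>u\<in>U. f u x) \<in> ell2 S"
    using insert.prems by (auto intro: ell2_sum)
  from add[rule_format, OF this]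
  have "A (\<lambda>x. f u x + (\<Sum>u\<in>U. f u x)) = (\<lambda>y. A (f u) y + A (\<lambda>x. \<Sum>u\<in>U. f u x) y)" .
  then show ?case using insert by simp
qed

lemma ell2_expand:
  assumes "finite S" "\<phi> \<in> ell2 S"
  shows "\<phi> = (\<lambda>z. \<Sum>x\<in>S. \<phi> x * indicator {x} z)"
proof
  fix z
  have "(\<Sum>x\<in>S. \<phi> x * indicator {x} z) = (\<Sum>x\<in>S. if x = z then \<phi> z else 0)"
    by (intro sum.cong) (auto simp: indicator_def)
  then show "\<phi> z = (\<Sum>x\<in>S. \<phi> x * indicator {x} z)"
    using assms by (simp add: ell2_def)
qed

lemma ell2_linear_expand:
  assumes "finite S" "ell2_linear S T A" "\<phi> \<in> ell2 S"
  shows "A \<phi> y = (\<Sum>x\<in>S. \<phi> x * A (indicator {x}) y)"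
proof -
  have "A \<phi> = A (\<lambda>z. \<Sum>x\<in>S. \<phi> x * indicator {x} z)"
    using ell2_expand[OF assms(1,3)] by simp
  also have "\<dots> = (\<lambda>y. \<Sum>x\<in>S. A (\<lambda>z. \<phi> x * indicator {x} z) y)"
    by (rule ell2_linear_sum[OF assms(2,1)]) (simp add: ell2_scale ell2_indicator)
  also have "\<dots> = (\<lambda>y. \<Sum>x\<in>S. \<phi> x * A (indicator {x}) y)"
    using assms(2) by (intro ext sum.cong) (auto simp: ell2_linear_def ell2_indicator)
  finally show ?thesis by simp
qed

text \<open>The adjoint is a definite description. Testing against the indicators of the points of
  \<open>S\<close> determines its value at each of them, so it suffices to exhibit one
  candidate.\<close>

lemma ell2_adjoint_eqI:
  assumes "finite S" and "\<phi> \<in> ell2 S"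
    and "\<And>\<eta>. \<eta> \<in> ell2 S \<Longrightarrow> ell2_inner T (A \<eta>) \<psi> = ell2_inner S \<eta> \<phi>"
  shows "ell2_adjoint S T A \<psi> = \<phi>"
  unfolding ell2_adjoint_def
proof (rule the_equality)
  fix \<phi>' assume *: "\<phi>' \<in> ell2 S \<and> (\<forall>\<eta>\<in>ell2 S. ell2_inner T (A \<eta>) \<psi> = ell2_inner S \<eta> \<phi>')"
  have "\<phi>' x = \<phi> x" for x
  proof (cases "x \<in> S")
    case True
    then show ?thesis
      using * assms(3)[of "indicator {x}"] assms(1) by (simp add: ell2_inner_indicator ell2_indicator)
  next
    case False
    then show ?thesis using * assms(2) by (simp add: ell2_def)
  qed
  then show "\<phi>' = \<phi>" by blast
qed (use assms in auto)

section \<open>Eigenbases of symmetric operators\<close>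

locale ell2_symmetric =
  fixes S :: "'b set" and A :: "('b \<Rightarrow> real) \<Rightarrow> ('b \<Rightarrow> real)"
  assumes fin: "finite S"
    and linear: "ell2_linear S S A"
    and symmetric: "\<And>\<phi> \<psi>. \<phi> \<in> ell2 S \<Longrightarrow> \<psi> \<in> ell2 S \<Longrightarrow>
      ell2_inner S (A \<phi>) \<psi> = ell2_inner S \<phi> (A \<psi>)"
begin

abbreviation ip (infix "\<bullet>S" 70) where "\<phi> \<bullet>S \<psi> \<equiv> ell2_inner S \<phi> \<psi>"

lemma closed: "\<phi> \<in> ell2 S \<Longrightarrow> A \<phi> \<in> ell2 S"
  and add: "\<phi> \<in> ell2 S \<Longrightarrow> \<psi> \<in> ell2 S \<Longrightarrow> A (\<lambda>x. \<phi> x + \<psi> x) = (\<lambda>y. A \<phi> y + A \<psi> y)"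
  and scale: "\<phi> \<in> ell2 S \<Longrightarrow> A (\<lambda>x. c * \<phi> x) = (\<lambda>y. c * A \<phi> y)"
  using linear by (auto simp: ell2_linear_def)

text \<open>The constraints with \<open>U\<close> make this the unit sphere of an orthogonal
  complement, on which the Rayleigh quotient will be minimized. It is a closed subset of a box,
  which is compact by Tychonoff.\<close>

lemma compact_sphere:
  "compact {\<phi> \<in> ell2 S. (\<forall>u\<in>U. \<phi> \<bullet>S u = 0) \<and> \<phi> \<bullet>S \<phi> = 1}" (is "compact ?K")
proof -
  \<comment> \<open>Coordinates off \<open>S\<close> are pinned to 0, so the box lives in the space
    of all functions even if the underlying type is infinite.\<close>
  define P where "P = PiE UNIV (\<lambda>x. if x \<in> S then {-1..1::real} else {0})"
  have "compactin (product_topology (\<lambda>_. euclidean) UNIV) P"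
    unfolding P_def compactin_PiE by auto
  then have P: "compact P"
    by (simp add: euclidean_product_topology)
  have "?K \<subseteq> P"
  proof
    fix \<phi> assume \<phi>: "\<phi> \<in> ?K"
    have "\<bar>\<phi> x\<bar> \<le> 1" if "x \<in> S" for x
    proof -
      have "\<phi> x * \<phi> x \<le> (\<Sum>x\<in>S. \<phi> x * \<phi> x)"
        by (rule member_le_sum[OF that]) (auto simp: fin)
      then have "(\<phi> x)\<^sup>2 \<le> 1" using \<phi> by (simp add: ell2_inner_def power2_eq_square)
      then show ?thesis by (simp add: abs_square_le_1)
    qed
    then have "x \<in> S \<Longrightarrow> -1 \<le> \<phi> x \<and> \<phi> x \<le> 1" for x by (auto simp: abs_le_iff minus_le_iff)
    then show "\<phi> \<in> P" using \<phi> by (auto simp: P_def ell2_def)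
  qed
  moreover have "closed ?K"
  proof -
    have 1: "continuous_on UNIV (\<lambda>\<phi>. \<phi> \<bullet>S u)" for u
      unfolding ell2_inner_def by (intro continuous_intros) simp_all
    have 2: "continuous_on UNIV (\<lambda>\<phi>. \<phi> \<bullet>S \<phi>)"
      unfolding ell2_inner_def by (intro continuous_intros) simp_all
    have "?K = (\<Inter>x\<in>-S. {\<phi>. \<phi> x = 0}) \<inter> (\<Inter>u\<in>U. {\<phi>. \<phi> \<bullet>S u = 0}) \<inter> {\<phi>. \<phi> \<bullet>S \<phi> = 1}"
      by (auto simp: ell2_def)
    also have "closed \<dots>"
      by (intro closed_Int closed_INT ballI closed_Collect_eq 1 2) (auto intro!: continuous_intros)
    finally show ?thesis .
  qed
  ultimately show ?thesis using closed_Int_compact[OF _ P, of ?K] by (simp only: Int_absorb2)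
qed

text \<open>A minimizer of the Rayleigh quotient on the unit sphere of the complement
  \<open>W\<close> of \<open>U\<close> is an eigenvector: \<open>W\<close> is invariant under
  \<open>A\<close>, since \<open>U\<close> consists of eigenvectors and \<open>A\<close> is
  symmetric, and so contains the residual along which the minimizer is perturbed.\<close>

lemma ex_eigenvector_orthogonal:
  assumes U: "U \<subseteq> ell2 S" "\<And>u. u \<in> U \<Longrightarrow> \<exists>c. A u = (\<lambda>x. c * u x)"
    and ne: "\<phi>\<^sub>0 \<in> ell2 S" "\<forall>u\<in>U. \<phi>\<^sub>0 \<bullet>S u = 0" "\<phi>\<^sub>0 \<noteq> (\<lambda>_. 0)"
  obtains \<phi> c where "\<phi> \<in> ell2 S" "\<forall>u\<in>U. \<phi> \<bullet>S u = 0" "\<phi> \<bullet>S \<phi> = 1" "A \<phi> = (\<lambda>x. c * \<phi> x)"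
proof -
  define W where "W = {\<phi> \<in> ell2 S. \<forall>u\<in>U. \<phi> \<bullet>S u = 0}"
  define K where "K = {\<phi> \<in> ell2 S. (\<forall>u\<in>U. \<phi> \<bullet>S u = 0) \<and> \<phi> \<bullet>S \<phi> = 1}"
  have W_scale: "\<phi> \<in> W \<Longrightarrow> (\<lambda>x. c * \<phi> x) \<in> W" for \<phi> c
    by (auto simp: W_def ell2_scale ell2_inner_simps)
  have W_add: "\<phi> \<in> W \<Longrightarrow> \<psi> \<in> W \<Longrightarrow> (\<lambda>x. \<phi> x + \<psi> x) \<in> W" for \<phi> \<psi>
    by (auto simp: W_def ell2_add ell2_inner_simps)
  have W_diff: "\<phi> \<in> W \<Longrightarrow> \<psi> \<in> W \<Longrightarrow> (\<lambda>x. \<phi> x - \<psi> x) \<in> W" for \<phi> \<psi>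
    by (auto simp: W_def ell2_diff ell2_inner_simps)
  have W_A: "A \<phi> \<in> W" if "\<phi> \<in> W" for \<phi>
  proof -
    have "A \<phi> \<bullet>S u = 0" if u: "u \<in> U" for u
    proof -
      obtain c where "A u = (\<lambda>x. c * u x)" using U u by blast
      then have "\<phi> \<bullet>S A u = 0" using \<open>\<phi> \<in> W\<close> u by (simp add: W_def ell2_inner_simps)
      then show ?thesis using symmetric[of \<phi> u] \<open>\<phi> \<in> W\<close> u U by (auto simp: W_def)
    qed
    then show ?thesis using that closed by (auto simp: W_def)
  qed
  have unit: "(\<lambda>x. (1 / sqrt (\<psi> \<bullet>S \<psi>)) * \<psi> x) \<in> K" if "\<psi> \<in> W" "\<psi> \<noteq> (\<lambda>_. 0)" for \<psi>
  proof -
    have "\<psi> \<bullet>S \<psi> > 0"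
      using that ell2_inner_eq_0[OF fin] ell2_inner_ge_0[of S \<psi>] by (force simp: W_def)
    then have "(\<lambda>x. (1 / sqrt (\<psi> \<bullet>S \<psi>)) * \<psi> x) \<bullet>S (\<lambda>x. (1 / sqrt (\<psi> \<bullet>S \<psi>)) * \<psi> x) = 1"
      unfolding ell2_inner_scale_left ell2_inner_scale_right by (simp add: field_simps)
    then show ?thesis
      using W_scale[OF that(1), of "1 / sqrt (\<psi> \<bullet>S \<psi>)"] by (auto simp: K_def W_def)
  qed
  have "K \<noteq> {}" using unit[of \<phi>\<^sub>0] ne by (auto simp: W_def)
  moreover have "compact K" unfolding K_def by (rule compact_sphere)
  moreover have "continuous_on K (\<lambda>\<phi>. \<phi> \<bullet>S A \<phi>)"
  proof -
    \<comment> \<open>In terms of the matrix of \<open>A\<close>, the quadratic form is a polynomial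
      in finitely many coordinates.\<close>
    have "continuous_on K (\<lambda>\<phi>. \<Sum>x\<in>S. \<phi> x * (\<Sum>y\<in>S. \<phi> y * A (indicator {y}) x))"
      by (intro continuous_intros continuous_on_subset[OF continuous_on_product_coordinates]) auto
    moreover have "\<phi> \<bullet>S A \<phi> = (\<Sum>x\<in>S. \<phi> x * (\<Sum>y\<in>S. \<phi> y * A (indicator {y}) x))" if "\<phi> \<in> K" for \<phi>
      using that ell2_linear_expand[OF fin linear, of \<phi>] by (simp add: ell2_inner_def K_def)
    ultimately show ?thesis by (simp cong: continuous_on_cong)
  qed
  ultimately obtain \<phi> where \<phi>: "\<phi> \<in> K" "\<And>\<psi>. \<psi> \<in> K \<Longrightarrow> \<phi> \<bullet>S A \<phi> \<le> \<psi> \<bullet>S A \<psi>"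
    by (metis continuous_attains_inf)
  define c where "c = \<phi> \<bullet>S A \<phi>"
  have \<phi>W: "\<phi> \<in> W" and \<phi>1: "\<phi> \<bullet>S \<phi> = 1" using \<phi>(1) by (auto simp: K_def W_def)
  have rayleigh: "c * (\<psi> \<bullet>S \<psi>) \<le> \<psi> \<bullet>S A \<psi>" if "\<psi> \<in> W" for \<psi>
  proof (cases "\<psi> = (\<lambda>_. 0)")
    case True
    then show ?thesis by (simp add: ell2_inner_def)
  next
    case False
    define r where "r = \<psi> \<bullet>S \<psi>"
    have r: "r > 0"
      using that False ell2_inner_eq_0[OF fin] ell2_inner_ge_0[of S \<psi>] by (force simp: W_def r_def)
    have "c \<le> (\<lambda>x. (1 / sqrt r) * \<psi> x) \<bullet>S A (\<lambda>x. (1 / sqrt r) * \<psi> x)"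
      unfolding c_def r_def by (rule \<phi>(2)[OF unit[OF that False]])
    also have "\<dots> = (1 / sqrt r) * ((1 / sqrt r) * (\<psi> \<bullet>S A \<psi>))"
      using that unfolding W_def
      by (subst scale) (auto simp only: ell2_inner_scale_left ell2_inner_scale_right)
    also have "\<dots> = (\<psi> \<bullet>S A \<psi>) / r" using r by (simp add: field_simps)
    finally show ?thesis using r by (simp add: r_def[symmetric] field_simps)
  qed
  \<comment> \<open>The residual, which is to vanish. Along the line \<phi> + t \<psi>, its squared
    norm \<open>b\<close> is half the first-order coefficient of the form minus \<open>c\<close>
    times the squared norm, and \<open>e\<close> is the second-order coefficient.\<close>
  define \<psi> where "\<psi> = (\<lambda>x. A \<phi> x - c * \<phi> x)"
  have \<psi>W: "\<psi> \<in> W" unfolding \<psi>_def by (intro W_diff W_A W_scale \<phi>W)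
  have S: "\<phi> \<in> ell2 S" "\<psi> \<in> ell2 S" using \<phi>W \<psi>W by (auto simp: W_def)
  define e where "e = \<psi> \<bullet>S A \<psi> - c * (\<psi> \<bullet>S \<psi>)"
  define b where "b = \<psi> \<bullet>S \<psi>"
  have b: "\<psi> \<bullet>S A \<phi> - c * (\<psi> \<bullet>S \<phi>) = b"
  proof -
    have "\<psi> \<bullet>S (\<lambda>x. A \<phi> x - c * \<phi> x) = b" by (simp add: b_def flip: \<psi>_def)
    then show ?thesis by (simp only: ell2_inner_simps)
  qed
  have ineq: "0 \<le> 2 * t * b + t * t * e" for t
  proof -
    let ?\<chi> = "\<lambda>x. \<phi> x + t * \<psi> x"
    have "0 \<le> ?\<chi> \<bullet>S A ?\<chi> - c * (?\<chi> \<bullet>S ?\<chi>)"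
      using rayleigh[OF W_add[OF \<phi>W W_scale[OF \<psi>W]]] by simp
    also have "A ?\<chi> = (\<lambda>x. A \<phi> x + t * A \<psi> x)"
      using S by (simp add: add scale ell2_scale)
    also have "?\<chi> \<bullet>S (\<lambda>x. A \<phi> x + t * A \<psi> x) - c * (?\<chi> \<bullet>S ?\<chi>) =
        (\<phi> \<bullet>S A \<phi> - c * (\<phi> \<bullet>S \<phi>)) + t * (\<phi> \<bullet>S A \<psi> + \<psi> \<bullet>S A \<phi>)
          - t * c * (\<phi> \<bullet>S \<psi> + \<psi> \<bullet>S \<phi>) + t * t * e"
      by (simp add: ell2_inner_simps e_def algebra_simps)
    also have "\<phi> \<bullet>S A \<psi> = \<psi> \<bullet>S A \<phi>"
      using symmetric[OF S] by (simp add: ell2_inner_commute)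
    also have "\<phi> \<bullet>S \<psi> = \<psi> \<bullet>S \<phi>" by (rule ell2_inner_commute)
    finally show ?thesis using b \<phi>1 by (simp add: c_def[symmetric] algebra_simps)
  qed
  have "b = 0"
  proof (rule ccontr)
    assume "b \<noteq> 0"
    then have b0: "b > 0" using ell2_inner_ge_0[of S \<psi>] by (simp add: b_def)
    have e0: "e \<ge> 0" using rayleigh[OF \<psi>W] by (simp add: e_def)
    \<comment> \<open>With this choice 2 t b + t t e equals t b - t t, which is negative. The
      summand 1 keeps the denominator positive when \<open>e\<close> is 0.\<close>
    define t where "t = - b / (e + 1)"
    have te: "t * (e + 1) = - b" and t0: "t < 0"
      using e0 b0 by (auto simp: t_def divide_neg_pos)
    have "2 * t * b + t * t * e = t * b - t * t"
    proof -
      have "t * e = - b - t" using te by (simp add: algebra_simps)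
      then have "t * (t * e) = t * (- b - t)" by simp
      then show ?thesis by (simp add: algebra_simps)
    qed
    moreover have "t * b < 0" using t0 b0 by (simp add: mult_neg_pos)
    moreover have "t * t > 0" using t0 by (simp add: mult_neg_neg)
    ultimately show False using ineq[of t] by linarith
  qed
  then have "\<psi> = (\<lambda>_. 0)" using ell2_inner_eq_0[OF fin S(2)] by (simp add: b_def)
  then have "A \<phi> = (\<lambda>x. c * \<phi> x)" by (auto simp: \<psi>_def fun_eq_iff)
  then show ?thesis using that[of \<phi> c] \<phi>(1) by (auto simp: K_def)
qed

definition orthonormal_eigen :: "('b \<Rightarrow> real) set \<Rightarrow> bool" where
  "orthonormal_eigen U \<longleftrightarrow> finite U \<and> U \<subseteq> ell2 S \<and>
     (\<forall>u\<in>U. \<forall>v\<in>U. u \<bullet>S v = (if u = v then 1 else 0)) \<and>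
     (\<forall>u\<in>U. \<exists>c. A u = (\<lambda>x. c * u x))"

lemma orthonormal_eigen_residual:
  assumes "orthonormal_eigen U" "v \<in> U"
  shows "(\<lambda>x. \<phi> x - (\<Sum>u\<in>U. (\<phi> \<bullet>S u) * u x)) \<bullet>S v = 0"
proof -
  have "(\<Sum>u\<in>U. (\<phi> \<bullet>S u) * (u \<bullet>S v)) = (\<Sum>u\<in>U. if u = v then \<phi> \<bullet>S v else 0)"
    using assms by (intro sum.cong) (auto simp: orthonormal_eigen_def)
  also have "\<dots> = \<phi> \<bullet>S v" using assms by (simp add: orthonormal_eigen_def)
  finally show ?thesis by (simp add: ell2_inner_simps ell2_inner_sum_left)
qed

text \<open>Bessel's inequality for the unit vectors, summed over \<open>S\<close>.\<close>
lemma orthonormal_eigen_card: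
  assumes U: "orthonormal_eigen U"
  shows "card U \<le> card S"
proof -
  have bessel: "(\<Sum>u\<in>U. u x * u x) \<le> 1" if "x \<in> S" for x
  proof -
    define \<phi> where "\<phi> = (indicator {x} :: 'b \<Rightarrow> real)"
    define \<rho> where "\<rho> = (\<lambda>y. \<Sum>u\<in>U. (\<phi> \<bullet>S u) * u y)"
    have \<phi>u: "\<phi> \<bullet>S u = u x" for u
      unfolding \<phi>_def using fin that by (rule ell2_inner_indicator)
    \<comment> \<open>\<rho> is the orthogonal projection of \<phi> to the span of \<open>U\<close>,
      so \<phi> - \<rho> is orthogonal to it, and the squared norm of \<phi> - \<rho> is 1 minus the
      sum to be bounded.\<close>
    have "(\<lambda>y. \<phi> y - \<rho> y) \<bullet>S \<rho> = \<rho> \<bullet>S (\<lambda>y. \<phi> y - \<rho> y)" by (rule ell2_inner_commute)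
    also have "\<dots> = (\<Sum>u\<in>U. (\<phi> \<bullet>S u) * (u \<bullet>S (\<lambda>y. \<phi> y - \<rho> y)))"
      unfolding \<rho>_def ell2_inner_sum_left ell2_inner_scale_left ..
    also have "\<dots> = 0"
      using orthonormal_eigen_residual[OF U, of _ \<phi>]
      by (intro sum.neutral) (simp add: \<rho>_def ell2_inner_commute)
    finally have 0: "(\<lambda>y. \<phi> y - \<rho> y) \<bullet>S \<rho> = 0" .
    have "0 \<le> (\<lambda>y. \<phi> y - \<rho> y) \<bullet>S (\<lambda>y. \<phi> y - \<rho> y)" by (rule ell2_inner_ge_0)
    also have "\<dots> = (\<phi> \<bullet>S \<phi> - \<rho> \<bullet>S \<phi>) - (\<lambda>y. \<phi> y - \<rho> y) \<bullet>S \<rho>"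
      by (simp add: ell2_inner_diff_right ell2_inner_diff_left)
    also have "\<rho> \<bullet>S \<phi> = (\<Sum>u\<in>U. u x * u x)"
      unfolding \<rho>_def ell2_inner_sum_left ell2_inner_scale_left
      by (simp add: ell2_inner_commute[of S _ \<phi>] \<phi>u)
    also have "\<phi> \<bullet>S \<phi> = 1" unfolding \<phi>u by (simp add: \<phi>_def)
    finally show ?thesis using 0 by simp
  qed
  have "real (card U) = (\<Sum>u\<in>U. u \<bullet>S u)"
    using U by (simp add: orthonormal_eigen_def)
  also have "\<dots> = (\<Sum>x\<in>S. \<Sum>u\<in>U. u x * u x)"
    unfolding ell2_inner_def by (rule sum.swap)
  also have "\<dots> \<le> (\<Sum>x\<in>S. 1)" by (rule sum_mono) (rule bessel)
  finally show ?thesis by simp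
qed

text \<open>Orthonormal systems of eigenvectors have bounded cardinality, so one of maximal
  cardinality exists. If some expansion left a nonzero residual, there would be a further
  eigenvector orthogonal to the system.\<close>

lemma eigenbasis:
  obtains U c where "finite U" "\<And>u. u \<in> U \<Longrightarrow> u \<in> ell2 S" "\<And>u. u \<in> U \<Longrightarrow> u \<noteq> (\<lambda>_. 0)"
    "\<And>u. u \<in> U \<Longrightarrow> A u = (\<lambda>x. c u * u x)"
    "\<And>\<phi>. \<phi> \<in> ell2 S \<Longrightarrow> \<phi> = (\<lambda>x. \<Sum>u\<in>U. (\<phi> \<bullet>S u) * u x)"
proof -
  have "orthonormal_eigen {}" by (simp add: orthonormal_eigen_def)
  then obtain U where U: "orthonormal_eigen U"
    and max: "\<And>U'. orthonormal_eigen U' \<Longrightarrow> card U' \<le> card U"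
    using ex_has_greatest_nat[of orthonormal_eigen "{}" card "Suc (card S)"] orthonormal_eigen_card
    by (auto simp: less_Suc_eq_le)
  have "(\<lambda>x. \<phi> x - (\<Sum>u\<in>U. (\<phi> \<bullet>S u) * u x)) = (\<lambda>_. 0)" if \<phi>: "\<phi> \<in> ell2 S" for \<phi>
  proof (rule ccontr)
    assume ne: "(\<lambda>x. \<phi> x - (\<Sum>u\<in>U. (\<phi> \<bullet>S u) * u x)) \<noteq> (\<lambda>_. 0)"
    have "(\<lambda>x. \<phi> x - (\<Sum>u\<in>U. (\<phi> \<bullet>S u) * u x)) \<in> ell2 S"
      using U by (intro ell2_diff ell2_sum ell2_scale \<phi>) (auto simp: orthonormal_eigen_def)
    then obtain v c where v: "v \<in> ell2 S" "\<forall>u\<in>U. v \<bullet>S u = 0" "v \<bullet>S v = 1" "A v = (\<lambda>x. c * v x)"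
      using ex_eigenvector_orthogonal[of U, OF _ _ _ _ ne] U orthonormal_eigen_residual[OF U]
      by (auto simp: orthonormal_eigen_def)
    have "v \<notin> U" using v by auto
    have "\<forall>u\<in>U. u \<bullet>S v = 0" using v(2) by (subst ell2_inner_commute)
    with U v \<open>v \<notin> U\<close> have "orthonormal_eigen (insert v U)"
      by (auto simp: orthonormal_eigen_def)
    with \<open>v \<notin> U\<close> show False using max[of "insert v U"] U by (simp add: orthonormal_eigen_def)
  qed
  then have expand: "\<phi> = (\<lambda>x. \<Sum>u\<in>U. (\<phi> \<bullet>S u) * u x)" if "\<phi> \<in> ell2 S" for \<phi>
    using that by (simp add: fun_eq_iff)
  obtain c where c: "\<And>u. u \<in> U \<Longrightarrow> A u = (\<lambda>x. c u * u x)"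
    using U unfolding orthonormal_eigen_def by metis
  have "u \<noteq> (\<lambda>_. 0)" if "u \<in> U" for u
  proof
    assume "u = (\<lambda>_. 0)"
    then have "u \<bullet>S u = 0" by (simp add: ell2_inner_def)
    then show False using U that by (simp add: orthonormal_eigen_def)
  qed
  then show ?thesis using that[OF _ _ _ c expand] U unfolding orthonormal_eigen_def by blast
qed

section \<open>Spectrum, eigenvalues and the Rayleigh bound\<close>

lemma eigenvalue_in_spectrum:
  assumes "u \<in> ell2 S" "u \<noteq> (\<lambda>_. 0)" "A u = (\<lambda>x. c * u x)"
  shows "c \<in> ell2_spectrum S A"
proof -
  have "A (\<lambda>_. 0) = (\<lambda>_. 0)" by (rule ell2_linear_zero[OF linear])
  then have "\<not> inj_on (\<lambda>\<phi> x. A \<phi> x - c * \<phi> x) (ell2 S)"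
    using assms inj_onD[of "\<lambda>\<phi> x. A \<phi> x - c * \<phi> x" "ell2 S" u "\<lambda>_. 0"] by (auto simp: ell2_zero)
  then show ?thesis by (simp add: ell2_spectrum_def bij_betw_def)
qed

text \<open>The spectrum is defined by failure of bijectivity. If \<open>c\<close> is not an
  eigenvalue, A - c is injective by linearity, and surjective because it can be inverted
  coefficientwise in an eigenbasis.\<close>

lemma spectrum_eigenvalue:
  assumes "c \<in> ell2_spectrum S A"
  shows "\<exists>u\<in>ell2 S. u \<noteq> (\<lambda>_. 0) \<and> A u = (\<lambda>x. c * u x)"
proof (rule ccontr)
  assume "\<not> ?thesis"
  then have no: "u \<in> ell2 S \<Longrightarrow> u \<noteq> (\<lambda>_. 0) \<Longrightarrow> A u \<noteq> (\<lambda>x. c * u x)" for u by blast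
  obtain U c' where U: "finite U" and US: "\<And>u. u \<in> U \<Longrightarrow> u \<in> ell2 S"
    and U0: "\<And>u. u \<in> U \<Longrightarrow> u \<noteq> (\<lambda>_. 0)" and c': "\<And>u. u \<in> U \<Longrightarrow> A u = (\<lambda>x. c' u * u x)"
    and expand: "\<And>\<phi>. \<phi> \<in> ell2 S \<Longrightarrow> \<phi> = (\<lambda>x. \<Sum>u\<in>U. (\<phi> \<bullet>S u) * u x)"
    using eigenbasis by blast
  have ne: "c' u \<noteq> c" if "u \<in> U" for u
    using no[OF US[OF that] U0[OF that]] c'[OF that] by blast
  have "inj_on (\<lambda>\<phi> x. A \<phi> x - c * \<phi> x) (ell2 S)"
  proof (rule inj_onI)
    fix \<phi> \<psi> assume S: "\<phi> \<in> ell2 S" "\<psi> \<in> ell2 S"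
      and eq: "(\<lambda>x. A \<phi> x - c * \<phi> x) = (\<lambda>x. A \<psi> x - c * \<psi> x)"
    let ?\<chi> = "\<lambda>x. \<phi> x + (-1) * \<psi> x"
    have "A ?\<chi> = (\<lambda>y. A \<phi> y + A (\<lambda>x. (-1) * \<psi> x) y)" using S by (intro add ell2_scale)
    also have "A (\<lambda>x. (-1) * \<psi> x) = (\<lambda>y. (-1) * A \<psi> y)" using S by (intro scale)
    finally have "A ?\<chi> = (\<lambda>y. A \<phi> y + (-1) * A \<psi> y)" .
    also have "\<dots> = (\<lambda>x. c * ?\<chi> x)" using eq by (auto simp: fun_eq_iff algebra_simps)
    finally have "A ?\<chi> = (\<lambda>x. c * ?\<chi> x)" .
    moreover have "?\<chi> \<in> ell2 S" using S by (intro ell2_add ell2_scale)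
    ultimately have "?\<chi> = (\<lambda>_. 0)" using no[of ?\<chi>] by blast
    then show "\<phi> = \<psi>" by (auto simp: fun_eq_iff)
  qed
  moreover have "\<exists>\<phi>\<in>ell2 S. (\<lambda>x. A \<phi> x - c * \<phi> x) = \<psi>" if \<psi>: "\<psi> \<in> ell2 S" for \<psi>
  proof
    \<comment> \<open>The resolvent applied to \<psi>; the denominators are nonzero by
      \<open>ne\<close>.\<close>
    define \<phi> where "\<phi> = (\<lambda>x. \<Sum>u\<in>U. ((\<psi> \<bullet>S u) / (c' u - c)) * u x)"
    show "\<phi> \<in> ell2 S" unfolding \<phi>_def by (intro ell2_sum ell2_scale US)
    have "A \<phi> = (\<lambda>y. \<Sum>u\<in>U. A (\<lambda>x. ((\<psi> \<bullet>S u) / (c' u - c)) * u x) y)"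
      unfolding \<phi>_def using U
      by (intro ell2_linear_sum[OF linear] ell2_scale US)
    also have "\<dots> = (\<lambda>y. \<Sum>u\<in>U. ((\<psi> \<bullet>S u) / (c' u - c)) * (c' u * u y))"
    proof (intro ext sum.cong refl)
      fix u y assume "u \<in> U"
      then show "A (\<lambda>x. ((\<psi> \<bullet>S u) / (c' u - c)) * u x) y = ((\<psi> \<bullet>S u) / (c' u - c)) * (c' u * u y)"
        using scale[OF US, of u "(\<psi> \<bullet>S u) / (c' u - c)"] c'[of u] by simp
    qed
    finally have A\<phi>: "A \<phi> = (\<lambda>y. \<Sum>u\<in>U. ((\<psi> \<bullet>S u) / (c' u - c)) * (c' u * u y))" .
    have "A \<phi> x - c * \<phi> x = (\<Sum>u\<in>U. (\<psi> \<bullet>S u) * u x)" for x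
      unfolding A\<phi> unfolding \<phi>_def sum_distrib_left sum_subtractf[symmetric]
    proof (intro sum.cong refl)
      fix u assume "u \<in> U"
      then have "c' u - c \<noteq> 0" using ne by simp
      then show "((\<psi> \<bullet>S u) / (c' u - c)) * (c' u * u x) - c * (((\<psi> \<bullet>S u) / (c' u - c)) * u x) =
          (\<psi> \<bullet>S u) * u x"
        by (simp add: divide_simps) (simp add: algebra_simps)
    qed
    then show "(\<lambda>x. A \<phi> x - c * \<phi> x) = \<psi>" using expand[OF \<psi>] by simp
  qed
  moreover have "(\<lambda>x. A \<phi> x - c * \<phi> x) \<in> ell2 S" if "\<phi> \<in> ell2 S" for \<phi>
    using that by (intro ell2_diff ell2_scale closed)
  ultimately have "bij_betw (\<lambda>\<phi> x. A \<phi> x - c * \<phi> x) (ell2 S) (ell2 S)"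
    unfolding bij_betw_def by blast
  then show False using assms by (simp add: ell2_spectrum_def)
qed

text \<open>In an eigenbasis both sides are sums over the squared coefficients of \<phi>, weighted
  by the minimum and by the eigenvalues. If \<open>S\<close> is empty, so is the spectrum, and its
  \<open>Min\<close> is unspecified, but then the sums are empty too.\<close>

lemma Min_spectrum_le_rayleigh:
  assumes \<phi>: "\<phi> \<in> ell2 S"
  shows "Min (ell2_spectrum S A) * (\<phi> \<bullet>S \<phi>) \<le> \<phi> \<bullet>S A \<phi>"
proof -
  obtain U c' where U: "finite U" and US: "\<And>u. u \<in> U \<Longrightarrow> u \<in> ell2 S"
    and U0: "\<And>u. u \<in> U \<Longrightarrow> u \<noteq> (\<lambda>_. 0)" and c': "\<And>u. u \<in> U \<Longrightarrow> A u = (\<lambda>x. c' u * u x)"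
    and expand: "\<And>\<phi>. \<phi> \<in> ell2 S \<Longrightarrow> \<phi> = (\<lambda>x. \<Sum>u\<in>U. (\<phi> \<bullet>S u) * u x)"
    using eigenbasis by blast
  \<comment> \<open>Finiteness is what makes \<open>Min\<close> meaningful. An eigenvector for
    \<open>c\<close> has a nonzero coefficient at some \<open>u\<close>, and symmetry then forces
    \<open>c\<close> to be the eigenvalue of \<open>u\<close>.\<close>
  have "ell2_spectrum S A \<subseteq> c' ` U"
  proof
    fix c assume "c \<in> ell2_spectrum S A"
    then obtain v where v: "v \<in> ell2 S" "v \<noteq> (\<lambda>_. 0)" "A v = (\<lambda>x. c * v x)"
      using spectrum_eigenvalue by blast
    have "\<exists>u\<in>U. v \<bullet>S u \<noteq> 0"
      using expand[OF v(1)] v(2) by (metis (no_types, lifting) mult_zero_left sum.neutral)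
    then obtain u where u: "u \<in> U" "v \<bullet>S u \<noteq> 0" by blast
    have "c * (v \<bullet>S u) = c' u * (v \<bullet>S u)"
      using symmetric[OF v(1) US[OF u(1)]] v(3) c'[OF u(1)] by (simp add: ell2_inner_simps)
    then show "c \<in> c' ` U" using u by auto
  qed
  then have finite: "finite (ell2_spectrum S A)"
    using U finite_surj by blast
  define r where "r u = (\<phi> \<bullet>S u) * (\<phi> \<bullet>S u)" for u
  have inner: "\<phi> \<bullet>S \<psi> = (\<Sum>u\<in>U. (\<phi> \<bullet>S u) * (u \<bullet>S \<psi>))" for \<psi>
    by (subst expand[OF \<phi>]) (simp add: ell2_inner_sum_left ell2_inner_scale_left)
  have "Min (ell2_spectrum S A) * (\<phi> \<bullet>S \<phi>) = (\<Sum>u\<in>U. Min (ell2_spectrum S A) * r u)"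
    unfolding inner[of \<phi>] sum_distrib_left by (simp add: r_def ell2_inner_commute)
  also have "\<dots> \<le> (\<Sum>u\<in>U. c' u * r u)"
  proof (intro sum_mono mult_right_mono Min_le finite)
    show "c' u \<in> ell2_spectrum S A" if "u \<in> U" for u
      using that US U0 c' by (intro eigenvalue_in_spectrum)
  qed (simp add: r_def)
  also have "\<dots> = \<phi> \<bullet>S A \<phi>"
    unfolding inner[of "A \<phi>"]
  proof (intro sum.cong refl)
    fix u assume u: "u \<in> U"
    have "u \<bullet>S A \<phi> = c' u * (u \<bullet>S \<phi>)"
      using symmetric[OF US[OF u] \<phi>] c'[OF u] by (simp add: ell2_inner_simps)
    then show "c' u * r u = (\<phi> \<bullet>S u) * (u \<bullet>S A \<phi>)" by (simp add: r_def ell2_inner_commute)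
  qed
  finally show ?thesis .
qed

end

section \<open>Norms of an operator and its adjoint\<close>

lemma ell2_inner_support:
  assumes "finite T" "S \<subseteq> T" "\<phi> \<in> ell2 S"
  shows "ell2_inner T \<phi> \<psi> = ell2_inner S \<phi> \<psi>" "ell2_inner T \<psi> \<phi> = ell2_inner S \<psi> \<phi>"
  unfolding ell2_inner_def using assms
  by (intro sum.mono_neutral_right; auto simp: ell2_def)+

lemma ell2_inner_Cauchy_Schwarz:
  "(ell2_inner S \<phi> \<psi>)\<^sup>2 \<le> ell2_inner S \<phi> \<phi> * ell2_inner S \<psi> \<psi>"
  using Cauchy_Schwarz_ineq_sum[of \<phi> \<psi> S] by (simp add: ell2_inner_def power2_eq_square)

text \<open>An operator and its adjoint have the same norm: apply Cauchy-Schwarz to the pairing of A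
  (B \<eta>) with \<eta> and divide by the squared norm of B \<eta>.\<close>

lemma ell2_adjoint_bound:
  assumes adj: "\<And>\<phi> \<eta>. \<phi> \<in> ell2 S \<Longrightarrow> \<eta> \<in> ell2 T \<Longrightarrow> ell2_inner T (A \<phi>) \<eta> = ell2_inner S \<phi> (B \<eta>)"
    and "0 \<le> c"
    and A: "\<And>\<phi>. \<phi> \<in> ell2 S \<Longrightarrow> ell2_inner T (A \<phi>) (A \<phi>) \<le> c * ell2_inner S \<phi> \<phi>"
    and \<eta>: "\<eta> \<in> ell2 T"
  shows "ell2_inner S (B \<eta>) (B \<eta>) \<le> c * ell2_inner T \<eta> \<eta>"
proof -
  \<comment> \<open>\<open>B \<eta>\<close> may be nonzero off \<open>S\<close>, as happens for
    \<open>down\<close> of a function on non-faces, so it is truncated before \<open>A\<close> is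
    applied.\<close>
  define \<phi> where "\<phi> x = (if x \<in> S then B \<eta> x else 0)" for x
  define b where "b = ell2_inner S (B \<eta>) (B \<eta>)"
  have \<phi>: "\<phi> \<in> ell2 S" by (simp add: \<phi>_def ell2_def)
  have b1: "ell2_inner S \<phi> \<phi> = b" and b2: "ell2_inner S \<phi> (B \<eta>) = b"
    by (simp_all add: b_def ell2_inner_def \<phi>_def)
  have "b * b = (ell2_inner T (A \<phi>) \<eta>)\<^sup>2"
    using adj[OF \<phi> \<eta>] b2 by (simp add: power2_eq_square)
  also have "\<dots> \<le> ell2_inner T (A \<phi>) (A \<phi>) * ell2_inner T \<eta> \<eta>"
    by (rule ell2_inner_Cauchy_Schwarz)
  also have "\<dots> \<le> c * b * ell2_inner T \<eta> \<eta>"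
    using A[OF \<phi>] b1 by (intro mult_right_mono) (auto simp: ell2_inner_ge_0)
  finally have "b * b \<le> b * (c * ell2_inner T \<eta> \<eta>)" by (simp add: mult_ac)
  moreover have "0 \<le> b" by (simp add: b_def ell2_inner_ge_0)
  moreover have "0 \<le> c * ell2_inner T \<eta> \<eta>" using \<open>0 \<le> c\<close> by (simp add: ell2_inner_ge_0)
  ultimately have "b \<le> c * ell2_inner T \<eta> \<eta>" by (cases "b = 0") auto
  then show ?thesis by (simp add: b_def)
qed

section \<open>Coboundary and boundary on the complete complex\<close>

locale coboundary_complex =
  fixes V :: "'a set" and \<Sigma> :: "'a set set"
    and \<delta>' :: "int \<Rightarrow> ('a set \<Rightarrow> real) \<Rightarrow> ('a set \<Rightarrow> real)"
  assumes finV: "finite V"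
    and complex: "abstract_complex V \<Sigma>"
    and coboundary: "coboundary_operators (Pow V) \<delta>'"
begin

abbreviation K where "K k \<equiv> faces (Pow V) k"
abbreviation F where "F k \<equiv> faces \<Sigma> k"
abbreviation N where "N k \<equiv> faces (Pow V) k - \<Sigma>"

lemma subcomplex: "\<sigma> \<in> \<Sigma> \<Longrightarrow> \<sigma> \<subseteq> V"
  and face_closed: "\<sigma> \<in> \<Sigma> \<Longrightarrow> \<tau> \<subseteq> \<sigma> \<Longrightarrow> \<tau> \<in> \<Sigma>"
  using complex by (auto simp: abstract_complex_def)

lemma finite_simplex: "\<sigma> \<subseteq> V \<Longrightarrow> finite \<sigma>"
  using finV by (rule rev_finite_subset)

lemma mem_K: "\<sigma> \<in> K k \<longleftrightarrow> \<sigma> \<subseteq> V \<and> int (card \<sigma>) = k + 1"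
  by (simp add: faces_def)

lemma F_eq: "F k = K k \<inter> \<Sigma>"
  using subcomplex by (auto simp: faces_def)

lemma finite_K: "finite (K k)"
  using finV by (auto simp: faces_def)

lemma finite_F: "finite (F k)"
  using finite_K by (simp add: F_eq)

lemma insert_K: "\<tau> \<in> K k \<Longrightarrow> x \<in> V - \<tau> \<Longrightarrow> insert x \<tau> \<in> K (k + 1)"
  using finite_simplex[of \<tau>] by (auto simp: mem_K)

lemma delete_K: "\<sigma> \<in> K (k + 1) \<Longrightarrow> y \<in> \<sigma> \<Longrightarrow> \<sigma> - {y} \<in> K k"
  using finite_simplex[of \<sigma>] card_Suc_Diff1[of \<sigma> y] by (auto simp: mem_K)

lemma facet_of_iff:
  assumes "\<sigma> \<subseteq> V"
  shows "\<tau> \<prec>f \<sigma> \<longleftrightarrow> (\<exists>y\<in>\<sigma>. \<tau> = \<sigma> - {y})"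
proof
  assume "\<tau> \<prec>f \<sigma>"
  then obtain y where "\<sigma> - \<tau> = {y}" "\<tau> \<subseteq> \<sigma>"
    by (auto simp: facet_of_def card_1_singleton_iff)
  then have "y \<in> \<sigma>" "\<tau> = \<sigma> - {y}" by auto
  then show "\<exists>y\<in>\<sigma>. \<tau> = \<sigma> - {y}" by blast
next
  assume "\<exists>y\<in>\<sigma>. \<tau> = \<sigma> - {y}"
  then obtain y where "y \<in> \<sigma>" "\<tau> = \<sigma> - {y}" by blast
  moreover from this have "\<sigma> - \<tau> = {y}" by auto
  ultimately show "\<tau> \<prec>f \<sigma>" by (auto simp: facet_of_def)
qed

section \<open>Incidence numbers and the identities between them\<close>

text \<open>The incidence number of two simplices. The degree is read off from the cardinality, so
  that no dimension index has to be carried along.\<close>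

definition s :: "'a set \<Rightarrow> 'a set \<Rightarrow> real" where
  "s \<tau> \<sigma> = \<delta>' (int (card \<tau>) - 1) (indicator {\<tau>}) \<sigma>"

text \<open>\<open>up\<close> and \<open>down\<close> are the coboundary of the complete complex and
  its adjoint in coordinates, for all degrees at once. They are not truncated to \<Sigma>; the index
  set of each inner product selects faces or non-faces.\<close>

definition up :: "('a set \<Rightarrow> real) \<Rightarrow> 'a set \<Rightarrow> real" where
  "up \<phi> \<sigma> = (\<Sum>y\<in>\<sigma>. s (\<sigma> - {y}) \<sigma> * \<phi> (\<sigma> - {y}))"

definition down :: "('a set \<Rightarrow> real) \<Rightarrow> 'a set \<Rightarrow> real" where
  "down \<psi> \<tau> = (\<Sum>x\<in>V - \<tau>. s \<tau> (insert x \<tau>) * \<psi> (insert x \<tau>))"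

lemma s_eq: "\<tau> \<in> K k \<Longrightarrow> s \<tau> \<sigma> = \<delta>' k (indicator {\<tau>}) \<sigma>"
  by (simp add: s_def mem_K)

lemma K_ge: "\<tau> \<in> K k \<Longrightarrow> -1 \<le> k"
  by (simp add: mem_K)

lemma \<delta>'_linear: "-1 \<le> k \<Longrightarrow> ell2_linear (K k) (K (k + 1)) (\<delta>' k)"
  using coboundary by (simp add: coboundary_operators_def)

lemma s_values:
  assumes "\<tau> \<in> K k" "\<sigma> \<in> K (k + 1)"
  shows "s \<tau> \<sigma> \<in> {1, -1, 0}" "s \<tau> \<sigma> \<noteq> 0 \<longleftrightarrow> \<tau> \<prec>f \<sigma>"
proof -
  have "-1 \<le> k" using assms(1) by (rule K_ge)
  with coboundary assms show "s \<tau> \<sigma> \<in> {1, -1, 0}" "s \<tau> \<sigma> \<noteq> 0 \<longleftrightarrow> \<tau> \<prec>f \<sigma>"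
    unfolding s_eq[OF assms(1)] coboundary_operators_def by blast+
qed

lemma s_square:
  assumes "\<tau> \<subseteq> V" "x \<in> V - \<tau>"
  shows "s \<tau> (insert x \<tau>) * s \<tau> (insert x \<tau>) = 1"
proof -
  have \<tau>: "\<tau> \<in> K (int (card \<tau>) - 1)" using assms by (simp add: mem_K)
  have "\<tau> \<prec>f insert x \<tau>" using assms facet_of_iff[of "insert x \<tau>" \<tau>] by auto
  then show ?thesis using s_values[OF \<tau> insert_K[OF \<tau> assms(2)]] by auto
qed

lemma \<delta>'_eq_up:
  assumes "-1 \<le> k" "\<phi> \<in> ell2 (K k)" "\<sigma> \<in> K (k + 1)"
  shows "\<delta>' k \<phi> \<sigma> = up \<phi> \<sigma>"
proof -
  have \<sigma>: "\<sigma> \<subseteq> V" using assms(3) by (simp add: mem_K)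
  have "\<delta>' k \<phi> \<sigma> = (\<Sum>\<tau>\<in>K k. \<phi> \<tau> * \<delta>' k (indicator {\<tau>}) \<sigma>)"
    by (rule ell2_linear_expand[OF finite_K \<delta>'_linear[OF assms(1)] assms(2)])
  also have "\<dots> = (\<Sum>\<tau>\<in>K k. s \<tau> \<sigma> * \<phi> \<tau>)"
    by (intro sum.cong) (simp_all add: s_eq)
  also have "\<dots> = (\<Sum>\<tau>\<in>(\<lambda>y. \<sigma> - {y}) ` \<sigma>. s \<tau> \<sigma> * \<phi> \<tau>)"
    using s_values(2)[OF _ assms(3)] facet_of_iff[OF \<sigma>] delete_K[OF assms(3)]
    by (intro sum.mono_neutral_right finite_K) auto
  also have "\<dots> = up \<phi> \<sigma>"
    unfolding up_def by (subst sum.reindex) (auto simp: inj_on_def)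
  finally show ?thesis .
qed

text \<open>The vanishing square of the coboundary, applied to the indicator of \<tau> and evaluated
  at \<tau> with \<open>x\<close> and \<open>y\<close> added: exactly two simplices lie strictly
  between, one for each order of adding the vertices.\<close>

lemma s_anticommute:
  assumes \<tau>: "\<tau> \<subseteq> V" and x: "x \<in> V - \<tau>" and y: "y \<in> V - \<tau>" and "x \<noteq> y"
  shows "s \<tau> (insert x \<tau>) * s (insert x \<tau>) (insert x (insert y \<tau>)) +
    s \<tau> (insert y \<tau>) * s (insert y \<tau>) (insert x (insert y \<tau>)) = 0"
proof -
  define k where "k = int (card \<tau>) - 1"
  define \<rho> where "\<rho> = insert x (insert y \<tau>)"
  define \<phi> where "\<phi> = (indicator {\<tau>} :: 'a set \<Rightarrow> real)"
  have k: "-1 \<le> k" and \<tau>K: "\<tau> \<in> K k" using \<tau> by (simp_all add: k_def mem_K)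
  have \<phi>: "\<phi> \<in> ell2 (K k)" unfolding \<phi>_def using \<tau>K by (rule ell2_indicator)
  have \<rho>: "\<rho> \<in> K (k + 1 + 1)"
    unfolding \<rho>_def using x y \<open>x \<noteq> y\<close> by (intro insert_K \<tau>K) auto
  have \<rho>y: "\<rho> - {x} = insert y \<tau>" and \<rho>x: "\<rho> - {y} = insert x \<tau>"
    using x y \<open>x \<noteq> y\<close> by (auto simp: \<rho>_def)
  have "\<delta>' k \<phi> \<in> ell2 (K (k + 1))" using \<delta>'_linear[OF k] \<phi> by (simp add: ell2_linear_def)
  then have "up (\<delta>' k \<phi>) \<rho> = \<delta>' (k + 1) (\<delta>' k \<phi>) \<rho>"
    using \<delta>'_eq_up[of "k + 1" "\<delta>' k \<phi>" \<rho>] \<rho> k by simp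
  also have "\<dots> = 0" using coboundary k \<phi> by (simp add: coboundary_operators_def)
  finally have "0 = (\<Sum>z\<in>\<rho>. s (\<rho> - {z}) \<rho> * s \<tau> (\<rho> - {z}))"
    by (simp add: up_def s_eq[OF \<tau>K] \<phi>_def)
  also have "\<dots> = (\<Sum>z\<in>{x, y}. s (\<rho> - {z}) \<rho> * s \<tau> (\<rho> - {z}))"
  proof (intro sum.mono_neutral_right ballI)
    show "finite \<rho>" using \<rho> finite_simplex by (simp add: mem_K)
    show "{x, y} \<subseteq> \<rho>" by (auto simp: \<rho>_def)
    fix z assume z: "z \<in> \<rho> - {x, y}"
    then have "\<not> \<tau> \<prec>f \<rho> - {z}" by (auto simp: \<rho>_def facet_of_def)
    moreover have "\<rho> - {z} \<in> K (k + 1)" using z by (intro delete_K \<rho>) auto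
    ultimately show "s (\<rho> - {z}) \<rho> * s \<tau> (\<rho> - {z}) = 0" using s_values(2)[OF \<tau>K] by auto
  qed
  finally show ?thesis using \<open>x \<noteq> y\<close> by (simp add: \<rho>x \<rho>y mult.commute) (simp add: \<rho>_def add_ac)
qed

text \<open>The previous identity multiplied by two of its signs, all signs having square 1. It
  trades going up and down through the top of a square of simplices for going through its bottom,
  which is what the off-diagonal terms below require.\<close>

lemma s_swap:
  assumes \<tau>: "\<tau> \<subseteq> V" and x: "x \<in> V - \<tau>" and y: "y \<in> V - \<tau>" and "x \<noteq> y"
  shows "s (insert x \<tau>) (insert x (insert y \<tau>)) * s (insert y \<tau>) (insert x (insert y \<tau>)) =
    - (s \<tau> (insert x \<tau>) * s \<tau> (insert y \<tau>))"
proof -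
  define a b c d where "a = s \<tau> (insert x \<tau>)" and "b = s (insert x \<tau>) (insert x (insert y \<tau>))"
    and "c = s \<tau> (insert y \<tau>)" and "d = s (insert y \<tau>) (insert x (insert y \<tau>))"
  have "a * b + c * d = 0"
    unfolding a_def b_def c_def d_def using assms by (rule s_anticommute)
  then have "(a * d) * (a * b) = (a * d) * (- (c * d))" by (simp add: add_eq_0_iff2)
  moreover have "a * a = 1" unfolding a_def using \<tau> x by (rule s_square)
  moreover have "d * d = 1"
    unfolding d_def using assms by (intro s_square) auto
  ultimately have "b * d = - (a * c)" by algebra
  then show ?thesis by (simp add: a_def b_def c_def d_def)
qed

text \<open>Double counting of the pairs of a simplex and one of its facets, with summands indexed
  by the facet and the extra vertex.\<close>

lemma flag_sum:
  "(\<Sum>\<sigma>\<in>K (k + 1). \<Sum>y\<in>\<sigma>. g (\<sigma> - {y}) y) = (\<Sum>\<tau>\<in>K k. \<Sum>x\<in>V - \<tau>. g \<tau> x)"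
proof -
  have "(\<Sum>(\<sigma>, y)\<in>Sigma (K (k + 1)) (\<lambda>\<sigma>. \<sigma>). g (\<sigma> - {y}) y) =
      (\<Sum>(\<tau>, x)\<in>Sigma (K k) (\<lambda>\<tau>. V - \<tau>). g \<tau> x)"
    by (rule sum.reindex_bij_witness[where i = "\<lambda>(\<tau>, x). (insert x \<tau>, x)"
          and j = "\<lambda>(\<sigma>, y). (\<sigma> - {y}, y)"])
      (use insert_K delete_K in \<open>auto simp: insert_absorb\<close>, auto simp: mem_K)
  then show ?thesis
    using finV finite_K finite_simplex by (subst (1 2) sum.Sigma) (auto simp: mem_K)
qed

lemma up_down_adjoint: "ell2_inner (K (k + 1)) (up \<phi>) \<psi> = ell2_inner (K k) \<phi> (down \<psi>)"
proof -
  \<comment> \<open>Each \<sigma> is rewritten as \<sigma> - {y} with \<open>y\<close> inserted, to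
    expose the form required by \<open>flag_sum\<close>.\<close>
  have "ell2_inner (K (k + 1)) (up \<phi>) \<psi> = (\<Sum>\<sigma>\<in>K (k + 1). \<Sum>y\<in>\<sigma>.
      s (\<sigma> - {y}) (insert y (\<sigma> - {y})) * \<phi> (\<sigma> - {y}) * \<psi> (insert y (\<sigma> - {y})))"
    by (simp add: ell2_inner_def up_def sum_distrib_right insert_absorb cong: sum.cong)
  also have "\<dots> = (\<Sum>\<tau>\<in>K k. \<Sum>x\<in>V - \<tau>. s \<tau> (insert x \<tau>) * \<phi> \<tau> * \<psi> (insert x \<tau>))"
    by (rule flag_sum)
  also have "\<dots> = ell2_inner (K k) \<phi> (down \<psi>)"
    by (simp add: ell2_inner_def down_def sum_distrib_left mult_ac)
  finally show ?thesis .
qed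

text \<open>On the diagonal, each vertex outside \<tau> contributes \<phi> \<tau> through
  \<open>down (up \<phi>)\<close> and each vertex of \<tau> through \<open>up (down \<phi>)\<close>,
  as signs square to 1. The off-diagonal terms cancel by \<open>s_swap\<close>.\<close>

lemma down_up_plus_up_down:
  assumes \<tau>: "\<tau> \<subseteq> V"
  shows "down (up \<phi>) \<tau> + up (down \<phi>) \<tau> = real (card V) * \<phi> \<tau>"
proof -
  have fin: "finite \<tau>" using \<tau> by (rule finite_simplex)
  \<comment> \<open>The exchange terms, which replace a vertex \<open>y\<close> of \<tau> by a
    vertex \<open>x\<close> outside. They enter the two halves with opposite signs.\<close>
  define C where "C = (\<Sum>x\<in>V - \<tau>. \<Sum>y\<in>\<tau>. s (\<tau> - {y}) \<tau> *
    (s (\<tau> - {y}) (insert x (\<tau> - {y})) * \<phi> (insert x (\<tau> - {y}))))"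
  have "down (up \<phi>) \<tau> = (\<Sum>x\<in>V - \<tau>. \<phi> \<tau> + (\<Sum>y\<in>\<tau>. - (s (\<tau> - {y}) \<tau> *
      (s (\<tau> - {y}) (insert x (\<tau> - {y})) * \<phi> (insert x (\<tau> - {y}))))))"
    unfolding down_def
  proof (rule sum.cong[OF refl])
    fix x assume x: "x \<in> V - \<tau>"
    have "up \<phi> (insert x \<tau>) = s \<tau> (insert x \<tau>) * \<phi> \<tau> +
        (\<Sum>y\<in>\<tau>. s (insert x \<tau> - {y}) (insert x \<tau>) * \<phi> (insert x \<tau> - {y}))"
      using x fin by (simp add: up_def)
    then have "s \<tau> (insert x \<tau>) * up \<phi> (insert x \<tau>) =
        s \<tau> (insert x \<tau>) * s \<tau> (insert x \<tau>) * \<phi> \<tau> +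
        (\<Sum>y\<in>\<tau>. s \<tau> (insert x \<tau>) * (s (insert x \<tau> - {y}) (insert x \<tau>) * \<phi> (insert x \<tau> - {y})))"
      by (simp add: distrib_left sum_distrib_left)
    also have "(\<Sum>y\<in>\<tau>. s \<tau> (insert x \<tau>) * (s (insert x \<tau> - {y}) (insert x \<tau>) * \<phi> (insert x \<tau> - {y}))) =
      (\<Sum>y\<in>\<tau>. - (s (\<tau> - {y}) \<tau> * (s (\<tau> - {y}) (insert x (\<tau> - {y})) * \<phi> (insert x (\<tau> - {y})))))"
    proof (rule sum.cong[OF refl])
      fix y assume y: "y \<in> \<tau>"
      have alg: "a * (b * p) = - (d * (c * p))" if "b * a = - (c * d)" for a b c d p :: real
        using that by algebra
      have "insert x \<tau> - {y} = insert x (\<tau> - {y})" and "insert y (\<tau> - {y}) = \<tau>" using x y by auto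
      \<comment> \<open>The square with bottom \<tau> - {y} and top \<tau> with \<open>x\<close>
        added.\<close>
      moreover have "s (insert x (\<tau> - {y})) (insert x (insert y (\<tau> - {y}))) *
          s (insert y (\<tau> - {y})) (insert x (insert y (\<tau> - {y}))) =
          - (s (\<tau> - {y}) (insert x (\<tau> - {y})) * s (\<tau> - {y}) (insert y (\<tau> - {y})))"
        using x y \<tau> by (intro s_swap) auto
      ultimately show "s \<tau> (insert x \<tau>) * (s (insert x \<tau> - {y}) (insert x \<tau>) * \<phi> (insert x \<tau> - {y})) =
          - (s (\<tau> - {y}) \<tau> * (s (\<tau> - {y}) (insert x (\<tau> - {y})) * \<phi> (insert x (\<tau> - {y}))))"
        by (simp add: alg)
    qed
    finally show "s \<tau> (insert x \<tau>) * up \<phi> (insert x \<tau>) = \<phi> \<tau> + (\<Sum>y\<in>\<tau>. - (s (\<tau> - {y}) \<tau> *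
      (s (\<tau> - {y}) (insert x (\<tau> - {y})) * \<phi> (insert x (\<tau> - {y})))))"
      by (simp add: s_square[OF \<tau> x])
  qed
  also have "\<dots> = real (card (V - \<tau>)) * \<phi> \<tau> - C"
    by (simp add: sum_subtractf sum_negf C_def)
  finally have 1: "down (up \<phi>) \<tau> = real (card (V - \<tau>)) * \<phi> \<tau> - C" .
  have "up (down \<phi>) \<tau> = (\<Sum>y\<in>\<tau>. \<phi> \<tau> + (\<Sum>x\<in>V - \<tau>. s (\<tau> - {y}) \<tau> *
      (s (\<tau> - {y}) (insert x (\<tau> - {y})) * \<phi> (insert x (\<tau> - {y})))))"
    unfolding up_def
  proof (rule sum.cong[OF refl])
    fix y assume y: "y \<in> \<tau>"
    have "V - (\<tau> - {y}) = insert y (V - \<tau>)" and ins: "insert y (\<tau> - {y}) = \<tau>" using y \<tau> by auto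
    then have "down \<phi> (\<tau> - {y}) = s (\<tau> - {y}) \<tau> * \<phi> \<tau> +
        (\<Sum>x\<in>V - \<tau>. s (\<tau> - {y}) (insert x (\<tau> - {y})) * \<phi> (insert x (\<tau> - {y})))"
      unfolding down_def using y finV by simp
    moreover have "s (\<tau> - {y}) \<tau> * s (\<tau> - {y}) \<tau> = 1"
      using s_square[of "\<tau> - {y}" y] y \<tau> ins by auto
    ultimately show "s (\<tau> - {y}) \<tau> * down \<phi> (\<tau> - {y}) = \<phi> \<tau> + (\<Sum>x\<in>V - \<tau>. s (\<tau> - {y}) \<tau> *
      (s (\<tau> - {y}) (insert x (\<tau> - {y})) * \<phi> (insert x (\<tau> - {y}))))"
      by (simp add: distrib_left sum_distrib_left flip: mult.assoc)
  qed
  also have "\<dots> = real (card \<tau>) * \<phi> \<tau> + C"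
    unfolding C_def by (simp add: sum.distrib sum.swap[of _ "V - \<tau>" \<tau>])
  finally have "up (down \<phi>) \<tau> = real (card \<tau>) * \<phi> \<tau> + C" .
  moreover have "real (card (V - \<tau>)) + real (card \<tau>) = real (card V)"
    using card_Diff_subset[OF fin \<tau>] card_mono[OF finV \<tau>] by simp
  ultimately show ?thesis using 1 by (simp flip: distrib_right)
qed

text \<open>Removing two vertices in either order leads to the same simplex with opposite signs. The
  formula version holds for arbitrary \<phi>, without a support condition.\<close>

lemma up_up:
  assumes \<rho>: "\<rho> \<subseteq> V"
  shows "up (up \<phi>) \<rho> = 0"
proof -
  \<comment> \<open>Set to 0 on the diagonal, so that both sums range over all of \<rho> and may be
    interchanged.\<close>
  define h where "h y z = (if y = z then 0 else
    s (\<rho> - {y}) \<rho> * (s (\<rho> - {y} - {z}) (\<rho> - {y}) * \<phi> (\<rho> - {y} - {z})))" for y z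
  have fin: "finite \<rho>" using \<rho> by (rule finite_simplex)
  have "up (up \<phi>) \<rho> = (\<Sum>y\<in>\<rho>. \<Sum>z\<in>\<rho>. h y z)"
    unfolding up_def sum_distrib_left h_def using fin
    by (intro sum.cong refl sum.mono_neutral_cong_left) auto
  also have "\<dots> = (\<Sum>y\<in>\<rho>. \<Sum>z\<in>\<rho>. - h z y)"
  proof (intro sum.cong refl)
    fix y z assume yz: "y \<in> \<rho>" "z \<in> \<rho>"
    show "h y z = - h z y"
    proof (cases "y = z")
      case True
      then show ?thesis by (simp add: h_def)
    next
      case False
      define \<tau> where "\<tau> = \<rho> - {y} - {z}"
      have "\<rho> - {y} = insert z \<tau>" "\<rho> - {z} = insert y \<tau>" "\<rho> = insert y (insert z \<tau>)"
        "\<rho> - {z} - {y} = \<tau>"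
        using yz False by (auto simp: \<tau>_def)
      moreover have "s \<tau> (insert y \<tau>) * s (insert y \<tau>) (insert y (insert z \<tau>)) +
          s \<tau> (insert z \<tau>) * s (insert z \<tau>) (insert y (insert z \<tau>)) = 0"
        using yz False \<rho> by (intro s_anticommute) (auto simp: \<tau>_def)
      moreover have "b * (a * p) = - (d * (c * p))" if "a * b + c * d = 0" for a b c d p :: real
        using that by algebra
      ultimately show ?thesis using False unfolding h_def \<tau>_def[symmetric] by simp
    qed
  qed
  also have "\<dots> = - (\<Sum>y\<in>\<rho>. \<Sum>z\<in>\<rho>. h y z)"
    by (subst sum.swap) (simp add: sum_negf)
  also have "\<dots> = - up (up \<phi>) \<rho>"
    unfolding up_def sum_distrib_left h_def using fin
    by (intro arg_cong[of _ _ uminus] sum.cong refl sum.mono_neutral_cong_right) auto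
  finally show ?thesis by simp
qed

section \<open>Faces and non-faces\<close>


text \<open>Subsets of faces are faces, so the boundary of a function on faces needs no truncation,
  in contrast to its coboundary.\<close>

lemma down_F: "\<psi> \<in> ell2 (F (k + 1)) \<Longrightarrow> down \<psi> \<in> ell2 (F k)"
  unfolding ell2_def
proof (safe)
  fix \<tau> assume \<psi>: "\<forall>x. x \<notin> F (k + 1) \<longrightarrow> \<psi> x = 0" and \<tau>: "\<tau> \<notin> F k"
  have "insert x \<tau> \<notin> F (k + 1)" if "x \<in> V - \<tau>" for x
  proof
    assume *: "insert x \<tau> \<in> F (k + 1)"
    then have "insert x \<tau> - {x} \<in> K k" "insert x \<tau> \<in> \<Sigma>"
      using delete_K[of "insert x \<tau>" k x] by (auto simp: F_eq simp del: Diff_insert0 insert_Diff1 insert_Diff_single)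
    then show False using \<tau> that face_closed[of "insert x \<tau>" \<tau>] by (auto simp: F_eq)
  qed
  then show "down \<psi> \<tau> = 0" using \<psi> by (auto simp: down_def intro: sum.neutral)
qed

lemma up_down_adjoint_F:
  assumes "\<phi> \<in> ell2 (F k)" "\<psi> \<in> ell2 (F (k + 1))"
  shows "ell2_inner (F (k + 1)) (up \<phi>) \<psi> = ell2_inner (F k) \<phi> (down \<psi>)"
  using up_down_adjoint[of k \<phi> \<psi>]
    ell2_inner_support(1)[OF finite_K _ assms(1), of k "down \<psi>"]
    ell2_inner_support(2)[OF finite_K _ assms(2), of "k + 1" "up \<phi>"] by (auto simp: F_eq)

text \<open>The map from faces to non-faces and its adjoint. Both images may spill over to other
  simplices; the index sets of the inner products cut them off.\<close>

lemma up_down_adjoint_N: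
  assumes "\<phi> \<in> ell2 (F k)" "\<eta> \<in> ell2 (N (k + 1))"
  shows "ell2_inner (N (k + 1)) (up \<phi>) \<eta> = ell2_inner (F k) \<phi> (down \<eta>)"
  using up_down_adjoint[of k \<phi> \<eta>]
    ell2_inner_support(1)[OF finite_K _ assms(1), of k "down \<eta>"]
    ell2_inner_support(2)[OF finite_K _ assms(2), of "k + 1" "up \<phi>"] by (auto simp: F_eq)

text \<open>Pairing \<open>down_up_plus_up_down\<close> with \<phi> gives the energy in the complete
  complex. Its coboundary part splits over faces and non-faces, and its boundary part lives on faces
  by \<open>down_F\<close>.\<close>

lemma energy_identity:
  assumes \<phi>: "\<phi> \<in> ell2 (F k)"
  shows "real (card V) * ell2_inner (F k) \<phi> \<phi> = ell2_inner (F (k + 1)) (up \<phi>) (up \<phi>) +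
    ell2_inner (N (k + 1)) (up \<phi>) (up \<phi>) + ell2_inner (F (k - 1)) (down \<phi>) (down \<phi>)"
proof -
  have FK: "F k \<subseteq> K k" for k by (simp add: F_eq)
  have "real (card V) * ell2_inner (F k) \<phi> \<phi> = real (card V) * ell2_inner (K k) \<phi> \<phi>"
    using ell2_inner_support(1)[OF finite_K FK \<phi>] by simp
  also have "\<dots> = (\<Sum>\<tau>\<in>K k. \<phi> \<tau> * (down (up \<phi>) \<tau> + up (down \<phi>) \<tau>))"
    unfolding ell2_inner_def sum_distrib_left
    by (intro sum.cong refl) (simp add: down_up_plus_up_down mem_K)
  \<comment> \<open>The index k - 1 + 1 prepares the second use of \<open>up_down_adjoint\<close>,
    in degree k - 1.\<close>
  also have "\<dots> = ell2_inner (K k) \<phi> (down (up \<phi>)) + ell2_inner (K (k - 1 + 1)) (up (down \<phi>)) \<phi>"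
    by (simp add: ell2_inner_def sum.distrib algebra_simps)
  also have "\<dots> = ell2_inner (K (k + 1)) (up \<phi>) (up \<phi>) + ell2_inner (K (k - 1)) (down \<phi>) (down \<phi>)"
    by (simp only: up_down_adjoint)
  also have "ell2_inner (K (k + 1)) (up \<phi>) (up \<phi>) =
      ell2_inner (F (k + 1)) (up \<phi>) (up \<phi>) + ell2_inner (N (k + 1)) (up \<phi>) (up \<phi>)"
    unfolding ell2_inner_def F_eq by (rule sum.Int_Diff[OF finite_K])
  also have "ell2_inner (K (k - 1)) (down \<phi>) (down \<phi>) = ell2_inner (F (k - 1)) (down \<phi>) (down \<phi>)"
    using down_F[of \<phi> "k - 1"] \<phi> by (intro ell2_inner_support(1) finite_K FK) simp
  finally show ?thesis by simp
qed

section \<open>Descent of norm bounds through the non-faces\<close>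

text \<open>\<open>c\<close> is any upper bound for the squared norm of the boundary from non-faces
  to faces. Working with bounds instead of the norm itself avoids suprema.\<close>

definition down_bounded :: "int \<Rightarrow> real \<Rightarrow> bool" where
  "down_bounded k c \<longleftrightarrow> (\<forall>\<eta>\<in>ell2 (N (k + 1)).
     ell2_inner (F k) (down \<eta>) (down \<eta>) \<le> c * ell2_inner (N (k + 1)) \<eta> \<eta>)"

text \<open>Entry to the descent, used in degree \<open>l\<close>; the converse below is the exit,
  used in degree \<open>k\<close>.\<close>

lemma up_bound_imp_down_bounded:
  assumes "0 \<le> c"
    and "\<And>\<phi>. \<phi> \<in> ell2 (F k) \<Longrightarrow>
      ell2_inner (N (k + 1)) (up \<phi>) (up \<phi>) \<le> c * ell2_inner (F k) \<phi> \<phi>"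
  shows "down_bounded k c"
  unfolding down_bounded_def
  using ell2_adjoint_bound[of "F k" "N (k + 1)" up down c] up_down_adjoint_N assms by blast

lemma down_bounded_imp_up_bound:
  assumes "0 \<le> c" "down_bounded k c" "\<phi> \<in> ell2 (F k)"
  shows "ell2_inner (N (k + 1)) (up \<phi>) (up \<phi>) \<le> c * ell2_inner (F k) \<phi> \<phi>"
proof (rule ell2_adjoint_bound[of "N (k + 1)" "F k" down up c])
  show "ell2_inner (F k) (down \<eta>) \<phi> = ell2_inner (N (k + 1)) \<eta> (up \<phi>)"
    if "\<eta> \<in> ell2 (N (k + 1))" "\<phi> \<in> ell2 (F k)" for \<eta> \<phi>
    using up_down_adjoint_N[OF that(2,1)] by (simp only: ell2_inner_commute)
qed (use assms in \<open>auto simp: down_bounded_def\<close>)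

text \<open>Turns the count of cofaces into a count of vertices, the form in which it meets a sum
  over exterior products.\<close>

lemma min_degree_le:
  assumes \<tau>: "\<tau> \<in> F k"
  shows "min_degree \<Sigma> k \<le> card {x \<in> V - \<tau>. insert x \<tau> \<in> \<Sigma>}"
proof -
  have "min_degree \<Sigma> k \<le> card {\<sigma> \<in> F (k + 1). \<tau> \<prec>f \<sigma>}"
    unfolding min_degree_def using \<tau> finite_F by (intro Min_le) auto
  also have "{\<sigma> \<in> F (k + 1). \<tau> \<prec>f \<sigma>} = (\<lambda>x. insert x \<tau>) ` {x \<in> V - \<tau>. insert x \<tau> \<in> \<Sigma>}"
  proof (intro equalityI subsetI)
    fix \<sigma> assume "\<sigma> \<in> {\<sigma> \<in> F (k + 1). \<tau> \<prec>f \<sigma>}"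
    then have \<sigma>: "\<sigma> \<in> \<Sigma>" "\<tau> \<prec>f \<sigma>" by (auto simp: F_eq)
    then obtain x where "x \<in> \<sigma>" "\<tau> = \<sigma> - {x}"
      using facet_of_iff[OF subcomplex[OF \<sigma>(1)]] by blast
    with \<sigma> subcomplex[OF \<sigma>(1)] have "\<sigma> = insert x \<tau>" "x \<in> V - \<tau>" by auto
    with \<sigma> show "\<sigma> \<in> (\<lambda>x. insert x \<tau>) ` {x \<in> V - \<tau>. insert x \<tau> \<in> \<Sigma>}" by blast
  next
    fix \<sigma> assume "\<sigma> \<in> (\<lambda>x. insert x \<tau>) ` {x \<in> V - \<tau>. insert x \<tau> \<in> \<Sigma>}"
    then obtain x where x: "x \<in> V - \<tau>" "insert x \<tau> \<in> \<Sigma>" "\<sigma> = insert x \<tau>" by blast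
    then have "\<exists>y\<in>insert x \<tau>. \<tau> = insert x \<tau> - {y}" by auto
    then show "\<sigma> \<in> {\<sigma> \<in> F (k + 1). \<tau> \<prec>f \<sigma>}"
      using x \<tau> insert_K[of \<tau> k x] facet_of_iff[OF subcomplex[OF x(2)]] by (auto simp: F_eq)
  qed
  also have "card \<dots> \<le> card {x \<in> V - \<tau>. insert x \<tau> \<in> \<Sigma>}"
    by (rule card_image_le) (simp add: finV)
  finally show ?thesis .
qed

text \<open>The exterior product with the vertex \<open>x\<close>. It preserves functions supported on
  non-faces, because these are closed under supersets; functions on faces would have to be
  truncated, which is why the descent argument is carried out on non-faces.\<close>
definition wedge :: "'a \<Rightarrow> ('a set \<Rightarrow> real) \<Rightarrow> 'a set \<Rightarrow> real" where
  "wedge x \<eta> \<rho> = (if x \<in> \<rho> then s (\<rho> - {x}) \<rho> * \<eta> (\<rho> - {x}) else 0)"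

lemma wedge_N:
  assumes x: "x \<in> V" and \<eta>: "\<eta> \<in> ell2 (N k)"
  shows "wedge x \<eta> \<in> ell2 (N (k + 1))"
proof -
  have "\<rho> \<in> N (k + 1)" if "x \<in> \<rho>" "\<rho> - {x} \<in> N k" for \<rho>
    using insert_K[of "\<rho> - {x}" k x] face_closed[of \<rho> "\<rho> - {x}"] that x by (auto simp: insert_absorb)
  then show ?thesis using \<eta> by (auto simp: ell2_def wedge_def)
qed

text \<open>In general the boundary of the exterior product with \<open>x\<close>, plus the exterior
  product of \<open>x\<close> with the boundary of \<eta>, is \<eta>. At a face the right side
  vanishes, because \<eta> lives on non-faces; the sign comes from \<open>s_swap\<close>.\<close>

lemma down_wedge:
  assumes \<eta>: "\<eta> \<in> ell2 (N (k + 1))" and \<tau>: "\<tau> \<subseteq> V" and x: "x \<in> V - \<tau>" and face: "insert x \<tau> \<in> \<Sigma>"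
  shows "down (wedge x \<eta>) (insert x \<tau>) = - (s \<tau> (insert x \<tau>) * down \<eta> \<tau>)"
proof -
  have "\<eta> (insert x \<tau>) = 0" using \<eta> face by (simp add: ell2_def)
  then have "down \<eta> \<tau> = (\<Sum>y\<in>V - \<tau> - {x}. s \<tau> (insert y \<tau>) * \<eta> (insert y \<tau>))"
    unfolding down_def using x finV by (subst sum.remove[of _ x]) auto
  then have "- (s \<tau> (insert x \<tau>) * down \<eta> \<tau>) =
      (\<Sum>y\<in>V - \<tau> - {x}. - (s \<tau> (insert x \<tau>) * s \<tau> (insert y \<tau>)) * \<eta> (insert y \<tau>))"
    by (simp add: sum_distrib_left sum_negf mult.assoc)
  also have "\<dots> = down (wedge x \<eta>) (insert x \<tau>)"
    unfolding down_def
  proof (rule sum.cong)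
    fix y assume "y \<in> V - insert x \<tau>"
    then have y: "y \<in> V - \<tau>" "x \<noteq> y" by auto
    have "insert y (insert x \<tau>) - {x} = insert y \<tau>" using x y by auto
    then show "- (s \<tau> (insert x \<tau>) * s \<tau> (insert y \<tau>)) * \<eta> (insert y \<tau>) =
        s (insert x \<tau>) (insert y (insert x \<tau>)) * wedge x \<eta> (insert y (insert x \<tau>))"
      using s_swap[OF \<tau> x y] by (simp add: wedge_def insert_commute[of y x] flip: mult.assoc)
  qed auto
  finally show ?thesis ..
qed

text \<open>A simplex of K (k + 1) has k + 2 vertices, hence n - k - 2 vertices outside, and the
  exterior product with each of these copies the value of \<eta> up to sign. This is the source of
  the denominators in the theorem.\<close>

lemma sum_wedge_norm:
  assumes \<eta>: "\<eta> \<in> ell2 (N (k + 1))"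
  shows "(\<Sum>x\<in>V. ell2_inner (N (k + 1 + 1)) (wedge x \<eta>) (wedge x \<eta>)) =
    real_of_int (int (card V) - k - 2) * ell2_inner (N (k + 1)) \<eta> \<eta>"
proof -
  have NK: "N j \<subseteq> K j" for j by blast
  have "(\<Sum>x\<in>V. ell2_inner (N (k + 1 + 1)) (wedge x \<eta>) (wedge x \<eta>)) =
      (\<Sum>x\<in>V. ell2_inner (K (k + 1 + 1)) (wedge x \<eta>) (wedge x \<eta>))"
    by (intro sum.cong refl ell2_inner_support(1)[symmetric] finite_K NK wedge_N \<eta>)
  also have "\<dots> = (\<Sum>\<rho>\<in>K (k + 1 + 1). \<Sum>x\<in>V. wedge x \<eta> \<rho> * wedge x \<eta> \<rho>)"
    unfolding ell2_inner_def by (subst sum.swap) simp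
  also have "\<dots> = (\<Sum>\<rho>\<in>K (k + 1 + 1). \<Sum>x\<in>\<rho>. \<eta> (\<rho> - {x}) * \<eta> (\<rho> - {x}))"
  proof (rule sum.cong[OF refl])
    fix \<rho> assume \<rho>: "\<rho> \<in> K (k + 1 + 1)"
    have "(\<Sum>x\<in>V. wedge x \<eta> \<rho> * wedge x \<eta> \<rho>) = (\<Sum>x\<in>\<rho>. wedge x \<eta> \<rho> * wedge x \<eta> \<rho>)"
      using \<rho> by (intro sum.mono_neutral_right finV) (auto simp: wedge_def mem_K)
    also have "\<dots> = (\<Sum>x\<in>\<rho>. \<eta> (\<rho> - {x}) * \<eta> (\<rho> - {x}))"
    proof (rule sum.cong[OF refl])
      fix x assume x: "x \<in> \<rho>"
      then have "s (\<rho> - {x}) \<rho> * s (\<rho> - {x}) \<rho> = 1"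
        using s_square[of "\<rho> - {x}" x] \<rho> by (auto simp: mem_K insert_absorb)
      moreover have "a * b * (a * b) = b * b" if "a * a = 1" for a b :: real
        using that by algebra
      ultimately show "wedge x \<eta> \<rho> * wedge x \<eta> \<rho> = \<eta> (\<rho> - {x}) * \<eta> (\<rho> - {x})"
        using x by (simp add: wedge_def)
    qed
    finally show "(\<Sum>x\<in>V. wedge x \<eta> \<rho> * wedge x \<eta> \<rho>) = (\<Sum>x\<in>\<rho>. \<eta> (\<rho> - {x}) * \<eta> (\<rho> - {x}))" .
  qed
  also have "\<dots> = (\<Sum>\<sigma>\<in>K (k + 1). \<Sum>x\<in>V - \<sigma>. \<eta> \<sigma> * \<eta> \<sigma>)"
    by (rule flag_sum)
  also have "\<dots> = (\<Sum>\<sigma>\<in>K (k + 1). real_of_int (int (card V) - k - 2) * (\<eta> \<sigma> * \<eta> \<sigma>))"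
  proof (rule sum.cong[OF refl])
    fix \<sigma> assume \<sigma>: "\<sigma> \<in> K (k + 1)"
    then have "int (card (V - \<sigma>)) = int (card V) - k - 2"
      using card_Diff_subset[of \<sigma> V] card_mono[OF finV, of \<sigma>] finite_simplex[of \<sigma>] by (auto simp: mem_K)
    then have "real (card (V - \<sigma>)) = real_of_int (int (card V) - k - 2)" by (metis of_int_of_nat_eq)
    then show "(\<Sum>x\<in>V - \<sigma>. \<eta> \<sigma> * \<eta> \<sigma>) = real_of_int (int (card V) - k - 2) * (\<eta> \<sigma> * \<eta> \<sigma>)"
      by simp
  qed
  also have "\<dots> = real_of_int (int (card V) - k - 2) * ell2_inner (K (k + 1)) \<eta> \<eta>"
    by (simp add: ell2_inner_def sum_distrib_left)
  also have "ell2_inner (K (k + 1)) \<eta> \<eta> = ell2_inner (N (k + 1)) \<eta> \<eta>"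
    using \<eta> by (intro ell2_inner_support(1) finite_K NK)
  finally show ?thesis .
qed

text \<open>Each face \<tau> extends to a face by at least \<open>min_degree \<Sigma> k\<close>
  vertices \<open>x\<close>, and for each of these \<open>down_wedge\<close> reproduces the square
  of \<open>down \<eta> \<tau>\<close> on the right. The remaining terms there are squares and are
  dropped.\<close>

lemma min_degree_le_sum_wedge:
  assumes \<eta>: "\<eta> \<in> ell2 (N (k + 1))"
  shows "real (min_degree \<Sigma> k) * ell2_inner (F k) (down \<eta>) (down \<eta>) \<le>
    (\<Sum>x\<in>V. ell2_inner (F (k + 1)) (down (wedge x \<eta>)) (down (wedge x \<eta>)))"
proof -
  \<comment> \<open>Vanishes unless the larger simplex is a face. The sum can thus be extended to
    the complete complex, rearranged by \<open>flag_sum\<close> and restricted to faces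
    again.\<close>
  define g where "g \<tau> x = (if insert x \<tau> \<in> \<Sigma> then down \<eta> \<tau> * down \<eta> \<tau> else 0)" for \<tau> x
  have "real (min_degree \<Sigma> k) * ell2_inner (F k) (down \<eta>) (down \<eta>) \<le>
      (\<Sum>\<tau>\<in>F k. \<Sum>x\<in>V - \<tau>. g \<tau> x)"
    unfolding ell2_inner_def sum_distrib_left
  proof (rule sum_mono)
    fix \<tau> assume \<tau>: "\<tau> \<in> F k"
    have "real (min_degree \<Sigma> k) * (down \<eta> \<tau> * down \<eta> \<tau>) \<le>
        real (card {x \<in> V - \<tau>. insert x \<tau> \<in> \<Sigma>}) * (down \<eta> \<tau> * down \<eta> \<tau>)"
      using min_degree_le[OF \<tau>] by (intro mult_right_mono) auto
    also have "\<dots> = (\<Sum>x\<in>V - \<tau>. g \<tau> x)"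
      unfolding g_def using finV by (simp add: sum.inter_filter[symmetric])
    finally show "real (min_degree \<Sigma> k) * (down \<eta> \<tau> * down \<eta> \<tau>) \<le> (\<Sum>x\<in>V - \<tau>. g \<tau> x)" .
  qed
  also have "\<dots> = (\<Sum>\<tau>\<in>K k. \<Sum>x\<in>V - \<tau>. g \<tau> x)"
    using face_closed[OF _ subset_insertI]
    by (intro sum.mono_neutral_left finite_K) (auto simp: F_eq g_def split: if_splits intro!: sum.neutral)
  also have "\<dots> = (\<Sum>\<sigma>\<in>K (k + 1). \<Sum>x\<in>\<sigma>. g (\<sigma> - {x}) x)" by (rule flag_sum[symmetric])
  also have "\<dots> = (\<Sum>\<sigma>\<in>F (k + 1). \<Sum>x\<in>\<sigma>. g (\<sigma> - {x}) x)"
    by (intro sum.mono_neutral_right finite_K) (auto simp: F_eq g_def insert_absorb intro!: sum.neutral)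
  also have "\<dots> \<le> (\<Sum>\<sigma>\<in>F (k + 1). \<Sum>x\<in>V. down (wedge x \<eta>) \<sigma> * down (wedge x \<eta>) \<sigma>)"
  proof (rule sum_mono)
    fix \<sigma> assume "\<sigma> \<in> F (k + 1)"
    then have \<sigma>: "\<sigma> \<in> \<Sigma>" "\<sigma> \<subseteq> V" using subcomplex by (auto simp: F_eq)
    have "(\<Sum>x\<in>\<sigma>. g (\<sigma> - {x}) x) = (\<Sum>x\<in>\<sigma>. down (wedge x \<eta>) \<sigma> * down (wedge x \<eta>) \<sigma>)"
    proof (rule sum.cong[OF refl])
      fix x assume x: "x \<in> \<sigma>"
      define \<tau> where "\<tau> = \<sigma> - {x}"
      have \<sigma>_eq: "\<sigma> = insert x \<tau>" using x by (auto simp: \<tau>_def)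
      have \<tau>: "\<tau> \<subseteq> V" "x \<in> V - \<tau>" using \<sigma> x by (auto simp: \<tau>_def)
      have "a * b * (a * b) = b * b" if "a * a = 1" for a b :: real
        using that by algebra
      with s_square[OF \<tau>] show "g (\<sigma> - {x}) x = down (wedge x \<eta>) \<sigma> * down (wedge x \<eta>) \<sigma>"
        using \<sigma>(1) down_wedge[OF \<eta> \<tau>] by (simp add: g_def flip: \<tau>_def \<sigma>_eq)
    qed
    \<comment> \<open>Vertices outside \<sigma> only add squares.\<close>
    also have "\<dots> \<le> (\<Sum>x\<in>V. down (wedge x \<eta>) \<sigma> * down (wedge x \<eta>) \<sigma>)"
      using \<sigma> finV by (intro sum_mono2) auto
    finally show "(\<Sum>x\<in>\<sigma>. g (\<sigma> - {x}) x) \<le> (\<Sum>x\<in>V. down (wedge x \<eta>) \<sigma> * down (wedge x \<eta>) \<sigma>)" .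
  qed
  also have "\<dots> = (\<Sum>x\<in>V. ell2_inner (F (k + 1)) (down (wedge x \<eta>)) (down (wedge x \<eta>)))"
    unfolding ell2_inner_def by (rule sum.swap)
  finally show ?thesis .
qed

text \<open>The bound in degree k + 1 is applied to the exterior products of \<eta> with all
  vertices; the two preceding lemmas evaluate the resulting sums. The quotient is nested so that
  iteration yields the product in the theorem.\<close>

lemma down_bounded_step:
  assumes "down_bounded (k + 1) c" "0 < min_degree \<Sigma> k" "k + 2 < int (card V)"
  shows "down_bounded k (c / (real (min_degree \<Sigma> k) / real_of_int (int (card V) - k - 2)))"
  unfolding down_bounded_def
proof
  fix \<eta> assume \<eta>: "\<eta> \<in> ell2 (N (k + 1))"
  have "real (min_degree \<Sigma> k) * ell2_inner (F k) (down \<eta>) (down \<eta>) \<le>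
      (\<Sum>x\<in>V. ell2_inner (F (k + 1)) (down (wedge x \<eta>)) (down (wedge x \<eta>)))"
    using \<eta> by (rule min_degree_le_sum_wedge)
  also have "\<dots> \<le> (\<Sum>x\<in>V. c * ell2_inner (N (k + 1 + 1)) (wedge x \<eta>) (wedge x \<eta>))"
    using assms(1) wedge_N[OF _ \<eta>] by (intro sum_mono) (auto simp: down_bounded_def)
  also have "\<dots> = c * (real_of_int (int (card V) - k - 2) * ell2_inner (N (k + 1)) \<eta> \<eta>)"
    unfolding sum_distrib_left[symmetric] sum_wedge_norm[OF \<eta>] ..
  finally show "ell2_inner (F k) (down \<eta>) (down \<eta>) \<le>
      c / (real (min_degree \<Sigma> k) / real_of_int (int (card V) - k - 2)) * ell2_inner (N (k + 1)) \<eta> \<eta>"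
    using assms(2) by (simp add: pos_le_divide_eq mult_ac)
qed

text \<open>The topmost step, in degree k + m - 1, is taken first and changes the bound, so
  \<open>c\<close> is generalized in the induction. The condition on the number of vertices is the
  one that this step requires.\<close>

lemma down_bounded_descend:
  fixes m :: nat
  assumes "down_bounded (k + int m) c"
    and "\<And>i. 0 \<le> i \<Longrightarrow> i < int m \<Longrightarrow> 0 < min_degree \<Sigma> (k + i)"
    and "k + int m + 1 < int (card V)"
  shows "down_bounded k
    (c / (\<Prod>i = 0..int m - 1. real (min_degree \<Sigma> (k + i)) / real_of_int (int (card V) - k - i - 2)))"
  using assms
proof (induction m arbitrary: c)
  case 0
  then show ?case by simp
next
  case (Suc m)
  let ?r = "\<lambda>i. real (min_degree \<Sigma> (k + i)) / real_of_int (int (card V) - k - i - 2)"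
  have "down_bounded (k + int m) (c / ?r (int m))"
    using down_bounded_step[of "k + int m" c] Suc.prems(1) Suc.prems(2)[of "int m"] Suc.prems(3)
    by (simp add: algebra_simps)
  then have "down_bounded k (c / ?r (int m) / (\<Prod>i = 0..int m - 1. ?r i))"
    using Suc.prems by (intro Suc.IH) auto
  moreover have "{0..int (Suc m) - 1} = insert (int m) {0..int m - 1}" by auto
  ultimately show ?case by (simp add: mult_ac)
qed

section \<open>Hodge Laplacian and cohomology\<close>


lemma ell2_FK: "\<phi> \<in> ell2 (F k) \<Longrightarrow> \<phi> \<in> ell2 (K k)"
  by (auto simp: ell2_def F_eq)

lemma cobd_eq:
  assumes "-1 \<le> k" "\<phi> \<in> ell2 (F k)"
  shows "cobd \<delta>' \<Sigma> k \<phi> = (\<lambda>\<sigma>. if \<sigma> \<in> F (k + 1) then up \<phi> \<sigma> else 0)"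
  using \<delta>'_eq_up[OF assms(1) ell2_FK[OF assms(2)]] by (auto simp: cobd_def F_eq)

lemma cobd_F: "cobd \<delta>' \<Sigma> k \<phi> \<in> ell2 (F (k + 1))"
  by (simp add: cobd_def ell2_def)

lemma cobd_F': "cobd \<delta>' \<Sigma> (k - 1) \<phi> \<in> ell2 (F k)"
  using cobd_F[of "k - 1"] by simp

lemma up_add: "up (\<lambda>x. \<phi> x + \<psi> x) = (\<lambda>x. up \<phi> x + up \<psi> x)"
  and up_scale: "up (\<lambda>x. c * \<phi> x) = (\<lambda>x. c * up \<phi> x)"
  and down_add: "down (\<lambda>x. \<phi> x + \<psi> x) = (\<lambda>x. down \<phi> x + down \<psi> x)"
  and down_scale: "down (\<lambda>x. c * \<phi> x) = (\<lambda>x. c * down \<phi> x)"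
  by (simp_all add: fun_eq_iff up_def down_def sum.distrib sum_distrib_left algebra_simps)

lemma cobd_linear:
  assumes "-1 \<le> k"
  shows "ell2_linear (F k) (F (k + 1)) (cobd \<delta>' \<Sigma> k)"
  unfolding ell2_linear_def using cobd_F
  by (auto simp: cobd_eq[OF assms, THEN fun_cong] ell2_add ell2_scale up_add up_scale fun_eq_iff)

lemma inner_cobd:
  assumes "-1 \<le> k" "\<phi> \<in> ell2 (F k)"
  shows "ell2_inner (F (k + 1)) (cobd \<delta>' \<Sigma> k \<phi>) \<psi> = ell2_inner (F (k + 1)) (up \<phi>) \<psi>"
  by (simp add: ell2_inner_def cobd_eq[OF assms])

text \<open>Here the definite description in the adjoint is evaluated: \<open>down \<psi>\<close> is
  supported on faces and satisfies the adjunction.\<close>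

lemma bd_eq:
  assumes "-1 \<le> k" "\<psi> \<in> ell2 (F (k + 1))"
  shows "bd \<delta>' \<Sigma> k \<psi> = down \<psi>"
  unfolding bd_def
  using assms by (intro ell2_adjoint_eqI finite_F down_F) (simp_all add: inner_cobd up_down_adjoint_F)

lemma hodge_laplacian_eq:
  assumes "0 \<le> k" "\<phi> \<in> ell2 (F k)"
  shows "hodge_laplacian \<delta>' \<Sigma> k \<phi> =
    (\<lambda>\<tau>. down (cobd \<delta>' \<Sigma> k \<phi>) \<tau> + cobd \<delta>' \<Sigma> (k - 1) (down \<phi>) \<tau>)"
  using assms bd_eq[OF _ cobd_F, of k \<phi>] bd_eq[of "k - 1" \<phi>] by (simp add: hodge_laplacian_def)

text \<open>Green's formula. Its right side is symmetric in \<phi> and \<psi>, and for equal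
  arguments it is a sum of two squared norms. The condition 0 \<le> k keeps the degree k - 1 within
  the range where coboundary operators are constrained.\<close>

lemma inner_hodge_laplacian:
  assumes k: "0 \<le> k" and \<phi>: "\<phi> \<in> ell2 (F k)" and \<psi>: "\<psi> \<in> ell2 (F k)"
  shows "ell2_inner (F k) (hodge_laplacian \<delta>' \<Sigma> k \<phi>) \<psi> =
    ell2_inner (F (k + 1)) (up \<phi>) (up \<psi>) + ell2_inner (F (k - 1)) (down \<phi>) (down \<psi>)"
proof -
  have "ell2_inner (F k) (down (cobd \<delta>' \<Sigma> k \<phi>)) \<psi> = ell2_inner (F (k + 1)) (up \<psi>) (cobd \<delta>' \<Sigma> k \<phi>)"
    using up_down_adjoint_F[OF \<psi> cobd_F] by (simp add: ell2_inner_commute)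
  also have "\<dots> = ell2_inner (F (k + 1)) (up \<phi>) (up \<psi>)"
    using inner_cobd[of k \<phi> "up \<psi>"] k \<phi> by (subst ell2_inner_commute) simp
  finally have 1: "ell2_inner (F k) (down (cobd \<delta>' \<Sigma> k \<phi>)) \<psi> = ell2_inner (F (k + 1)) (up \<phi>) (up \<psi>)" .
  have d: "down \<phi> \<in> ell2 (F (k - 1))" using down_F[of \<phi> "k - 1"] \<phi> by simp
  have "ell2_inner (F k) (cobd \<delta>' \<Sigma> (k - 1) (down \<phi>)) \<psi> = ell2_inner (F (k - 1)) (down \<phi>) (down \<psi>)"
    using inner_cobd[OF _ d, of \<psi>] up_down_adjoint_F[OF d, of \<psi>] k \<psi> by simp
  with 1 show ?thesis by (simp add: hodge_laplacian_eq[OF k \<phi>] ell2_inner_add_left)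
qed

lemma hodge_laplacian_symmetric:
  assumes k: "0 \<le> k"
  shows "ell2_symmetric (F k) (hodge_laplacian \<delta>' \<Sigma> k)"
proof
  show "finite (F k)" by (rule finite_F)
  have d: "down \<phi> \<in> ell2 (F (k - 1))" if "\<phi> \<in> ell2 (F k)" for \<phi>
    using down_F[of \<phi> "k - 1"] that by simp
  have add: "cobd \<delta>' \<Sigma> j (\<lambda>x. \<phi> x + \<psi> x) = (\<lambda>x. cobd \<delta>' \<Sigma> j \<phi> x + cobd \<delta>' \<Sigma> j \<psi> x)"
    and scale: "cobd \<delta>' \<Sigma> j (\<lambda>x. c * \<phi> x) = (\<lambda>x. c * cobd \<delta>' \<Sigma> j \<phi> x)"
    if "-1 \<le> j" "\<phi> \<in> ell2 (F j)" "\<psi> \<in> ell2 (F j)" for j \<phi> \<psi> c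
    using cobd_linear[OF that(1)] that(2,3) unfolding ell2_linear_def by blast+
  show "ell2_linear (F k) (F k) (hodge_laplacian \<delta>' \<Sigma> k)"
    unfolding ell2_linear_def
  proof (intro conjI ballI allI)
    fix \<phi> assume \<phi>: "\<phi> \<in> ell2 (F k)"
    show "hodge_laplacian \<delta>' \<Sigma> k \<phi> \<in> ell2 (F k)"
      unfolding hodge_laplacian_eq[OF k \<phi>] by (intro ell2_add down_F cobd_F cobd_F')
    fix \<psi> assume \<psi>: "\<psi> \<in> ell2 (F k)"
    show "hodge_laplacian \<delta>' \<Sigma> k (\<lambda>x. \<phi> x + \<psi> x) =
        (\<lambda>y. hodge_laplacian \<delta>' \<Sigma> k \<phi> y + hodge_laplacian \<delta>' \<Sigma> k \<psi> y)"
      using k by (simp add: hodge_laplacian_eq \<phi> \<psi> ell2_add add d down_add algebra_simps)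
  next
    fix c \<phi> assume \<phi>: "\<phi> \<in> ell2 (F k)"
    show "hodge_laplacian \<delta>' \<Sigma> k (\<lambda>x. c * \<phi> x) = (\<lambda>y. c * hodge_laplacian \<delta>' \<Sigma> k \<phi> y)"
      using k by (simp add: hodge_laplacian_eq \<phi> ell2_scale scale[of _ \<phi> \<phi>] scale[of _ "down \<phi>" "down \<phi>"]
          d down_scale algebra_simps)
  qed
  fix \<phi> \<psi> assume "\<phi> \<in> ell2 (F k)" "\<psi> \<in> ell2 (F k)"
  then show "ell2_inner (F k) (hodge_laplacian \<delta>' \<Sigma> k \<phi>) \<psi> =
      ell2_inner (F k) \<phi> (hodge_laplacian \<delta>' \<Sigma> k \<psi>)"
    using ell2_inner_commute[of "F k" \<phi> "hodge_laplacian \<delta>' \<Sigma> k \<psi>"]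
      ell2_inner_commute[of "F (k + 1)" "up \<phi>" "up \<psi>"]
      ell2_inner_commute[of "F (k - 1)" "down \<phi>" "down \<psi>"]
    by (simp add: inner_hodge_laplacian[OF k])
qed

section \<open>Harmonic functions and vanishing cohomology\<close>

text \<open>All facets of a face are faces, so the truncation inside \<open>cobd\<close> is
  invisible at \<sigma> and \<open>up_up\<close> applies.\<close>

lemma up_cobd:
  assumes k: "-1 \<le> k" and \<phi>: "\<phi> \<in> ell2 (F k)" and \<sigma>: "\<sigma> \<in> F (k + 1 + 1)"
  shows "up (cobd \<delta>' \<Sigma> k \<phi>) \<sigma> = 0"
proof -
  have "\<sigma> - {y} \<in> F (k + 1)" if "y \<in> \<sigma>" for y
    using \<sigma> that face_closed[of \<sigma> "\<sigma> - {y}"] delete_K[of \<sigma> "k + 1" y] by (auto simp: F_eq)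
  then have "up (cobd \<delta>' \<Sigma> k \<phi>) \<sigma> = up (up \<phi>) \<sigma>"
    unfolding cobd_eq[OF k \<phi>] up_def[of _ \<sigma>] by (intro sum.cong) auto
  also have "\<dots> = 0" using \<sigma> by (intro up_up) (auto simp: F_eq mem_K)
  finally show ?thesis .
qed

lemma cobd_cobd:
  assumes "0 \<le> k" "\<phi> \<in> ell2 (F (k - 1))"
  shows "cobd \<delta>' \<Sigma> k (cobd \<delta>' \<Sigma> (k - 1) \<phi>) = (\<lambda>_. 0)"
  using assms up_cobd[of "k - 1" \<phi>] by (auto simp: cobd_eq[OF _ cobd_F'] add.commute)

text \<open>Without harmonic functions 0 is not in the spectrum, so the Laplacian is surjective. A
  cocycle in its image is a boundary plus a coboundary; the boundary part is orthogonal to all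
  cocycles, hence to itself, and vanishes.\<close>

lemma cohomology_trivial:
  assumes k: "0 \<le> k"
    and harmonic: "\<And>\<phi>. \<phi> \<in> ell2 (F k) \<Longrightarrow> hodge_laplacian \<delta>' \<Sigma> k \<phi> = (\<lambda>_. 0) \<Longrightarrow> \<phi> = (\<lambda>_. 0)"
  shows "carrier (cohomology \<delta>' \<Sigma> k) = {\<one>\<^bsub>cohomology \<delta>' \<Sigma> k\<^esub>}"
proof -
  interpret ell2_symmetric "F k" "hodge_laplacian \<delta>' \<Sigma> k"
    using k by (rule hodge_laplacian_symmetric)
  define Z where "Z = {\<phi> \<in> ell2 (F k). cobd \<delta>' \<Sigma> k \<phi> = (\<lambda>_. 0)}"
  have lin: "ell2_linear (F k) (F (k + 1)) (cobd \<delta>' \<Sigma> k)" using k by (intro cobd_linear) simp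
  have "0 \<notin> ell2_spectrum (F k) (hodge_laplacian \<delta>' \<Sigma> k)"
    using spectrum_eigenvalue[of 0] harmonic by auto
  then have surj: "hodge_laplacian \<delta>' \<Sigma> k ` ell2 (F k) = ell2 (F k)"
    by (simp add: ell2_spectrum_def bij_betw_def)
  have "\<phi> \<in> cobd \<delta>' \<Sigma> (k - 1) ` ell2 (F (k - 1))" if "\<phi> \<in> Z" for \<phi>
  proof -
    have \<phi>: "\<phi> \<in> ell2 (F k)" and "cobd \<delta>' \<Sigma> k \<phi> = (\<lambda>_. 0)" using that by (auto simp: Z_def)
    have "\<phi> \<in> hodge_laplacian \<delta>' \<Sigma> k ` ell2 (F k)" using \<phi> by (simp only: surj)
    then obtain \<psi> where \<psi>: "\<psi> \<in> ell2 (F k)" and \<phi>_eq: "hodge_laplacian \<delta>' \<Sigma> k \<psi> = \<phi>"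
      by (elim imageE) simp
    define \<alpha> where "\<alpha> = down \<psi>"
    define \<chi> where "\<chi> = cobd \<delta>' \<Sigma> k \<psi>"
    have \<alpha>: "\<alpha> \<in> ell2 (F (k - 1))" using down_F[of \<psi> "k - 1"] \<psi> by (simp add: \<alpha>_def)
    have \<chi>: "\<chi> \<in> ell2 (F (k + 1))" unfolding \<chi>_def by (rule cobd_F)
    have decomp: "\<phi> = (\<lambda>\<tau>. down \<chi> \<tau> + cobd \<delta>' \<Sigma> (k - 1) \<alpha> \<tau>)"
      unfolding \<alpha>_def \<chi>_def by (simp add: hodge_laplacian_eq[OF k \<psi>] flip: \<phi>_eq)
    \<comment> \<open>By adjunction, the pairing equals that of the coboundary of \<beta> with
      \<chi>.\<close>
    have orth: "ell2_inner (F k) \<beta> (down \<chi>) = 0"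
      if "\<beta> \<in> ell2 (F k)" "cobd \<delta>' \<Sigma> k \<beta> = (\<lambda>_. 0)" for \<beta>
      using that inner_cobd[of k \<beta> \<chi>] k up_down_adjoint_F[OF _ \<chi>, of \<beta>] by (simp add: ell2_inner_def)
    have "ell2_inner (F k) \<phi> (down \<chi>) = 0"
      by (rule orth) fact+
    moreover have "ell2_inner (F k) (cobd \<delta>' \<Sigma> (k - 1) \<alpha>) (down \<chi>) = 0"
      using cobd_cobd[OF k \<alpha>] by (intro orth cobd_F')
    ultimately have "ell2_inner (F k) (down \<chi>) (down \<chi>) = 0"
      by (simp add: decomp ell2_inner_add_left)
    then have "down \<chi> = (\<lambda>_. 0)" using ell2_inner_eq_0[OF finite_F down_F[OF \<chi>]] by simp
    then show ?thesis using decomp \<alpha> by auto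
  qed
  moreover have "cobd \<delta>' \<Sigma> (k - 1) ` ell2 (F (k - 1)) \<subseteq> Z"
    using cobd_cobd[OF k] cobd_F' by (auto simp: Z_def)
  ultimately have image: "cobd \<delta>' \<Sigma> (k - 1) ` ell2 (F (k - 1)) = Z" by blast
  have Z0: "(\<lambda>_. 0) \<in> Z" using ell2_linear_zero[OF lin] by (simp add: Z_def ell2_zero)
  have Z_lin: "(\<lambda>x. \<phi> x + c * \<psi> x) \<in> Z" if "\<phi> \<in> Z" "\<psi> \<in> Z" for \<phi> \<psi> c
  proof -
    have S: "\<phi> \<in> ell2 (F k)" "\<psi> \<in> ell2 (F k)" using that by (auto simp: Z_def)
    have "cobd \<delta>' \<Sigma> k (\<lambda>x. \<phi> x + c * \<psi> x) = (\<lambda>x. cobd \<delta>' \<Sigma> k \<phi> x + c * cobd \<delta>' \<Sigma> k \<psi> x)"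
      using k S by (simp add: cobd_eq ell2_add ell2_scale up_add up_scale fun_eq_iff)
    then show ?thesis using that by (simp add: Z_def ell2_add ell2_scale)
  qed
  have coset: "(\<Union>h\<in>Z. {\<lambda>x. h x + a x}) = Z" if a: "a \<in> Z" for a
  proof (intro equalityI subsetI)
    fix \<phi> assume "\<phi> \<in> (\<Union>h\<in>Z. {\<lambda>x. h x + a x})"
    then show "\<phi> \<in> Z" using Z_lin[OF _ a, of _ 1] by auto
  next
    fix \<phi> assume "\<phi> \<in> Z"
    then have "(\<lambda>x. \<phi> x + (-1) * a x) \<in> Z" using a by (rule Z_lin)
    then show "\<phi> \<in> (\<Union>h\<in>Z. {\<lambda>x. h x + a x})" by force
  qed
  \<comment> \<open>The coboundaries fill the whole group \<open>Z\<close> of cocycles, so every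
    coset is \<open>Z\<close>, which is also the unit of the quotient.\<close>
  have "carrier (cohomology \<delta>' \<Sigma> k) = (\<Union>a\<in>Z. {\<Union>h\<in>Z. {\<lambda>x. h x + a x}})"
    by (simp add: cohomology_def image FactGroup_def RCOSETS_def r_coset_def cocycles_def Z_def)
  also have "\<dots> = {Z}" using coset Z0 by auto
  also have "Z = \<one>\<^bsub>cohomology \<delta>' \<Sigma> k\<^esub>"
    by (simp add: cohomology_def image FactGroup_def)
  finally show ?thesis .
qed

text \<open>For harmonic \<phi> the face and boundary parts of the energy vanish. The non-face part
  then equals n times the squared norm of \<phi>, while it is at most \<open>c\<close> times it with
  c < n.\<close>

lemma harmonic_zero:
  assumes k: "0 \<le> k" and c: "0 \<le> c" "c < real (card V)" "down_bounded k c"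
    and \<phi>: "\<phi> \<in> ell2 (F k)" and harmonic: "hodge_laplacian \<delta>' \<Sigma> k \<phi> = (\<lambda>_. 0)"
  shows "\<phi> = (\<lambda>_. 0)"
proof -
  have "ell2_inner (F (k + 1)) (up \<phi>) (up \<phi>) + ell2_inner (F (k - 1)) (down \<phi>) (down \<phi>) = 0"
    using inner_hodge_laplacian[OF k \<phi> \<phi>] harmonic by (simp add: ell2_inner_def)
  then have "real (card V) * ell2_inner (F k) \<phi> \<phi> = ell2_inner (N (k + 1)) (up \<phi>) (up \<phi>)"
    using energy_identity[OF \<phi>] by simp
  also have "\<dots> \<le> c * ell2_inner (F k) \<phi> \<phi>"
    using c(1,3) \<phi> by (rule down_bounded_imp_up_bound)
  finally have "(real (card V) - c) * ell2_inner (F k) \<phi> \<phi> \<le> 0"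
    by (simp add: algebra_simps)
  then have "ell2_inner (F k) \<phi> \<phi> \<le> 0" using c(2) by (simp add: mult_le_0_iff)
  then show ?thesis
    using ell2_inner_ge_0[of "F k" \<phi>] ell2_inner_eq_0[OF finite_F \<phi>] by simp
qed

text \<open>The energy identity turns the lower bound for the Laplacian by its least spectral value
  into an upper bound for the non-face part.\<close>

lemma hodge_min_bound:
  assumes k: "0 \<le> k" and \<phi>: "\<phi> \<in> ell2 (F k)"
  shows "ell2_inner (N (k + 1)) (up \<phi>) (up \<phi>) \<le>
    (real (card V) - hodge_min \<delta>' \<Sigma> k) * ell2_inner (F k) \<phi> \<phi>"
proof -
  interpret ell2_symmetric "F k" "hodge_laplacian \<delta>' \<Sigma> k"
    using k by (rule hodge_laplacian_symmetric)
  have "hodge_min \<delta>' \<Sigma> k * ell2_inner (F k) \<phi> \<phi> \<le> ell2_inner (F k) (hodge_laplacian \<delta>' \<Sigma> k \<phi>) \<phi>"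
    using Min_spectrum_le_rayleigh[OF \<phi>] unfolding hodge_min_def by (subst ell2_inner_commute)
  also have "\<dots> = real (card V) * ell2_inner (F k) \<phi> \<phi> - ell2_inner (N (k + 1)) (up \<phi>) (up \<phi>)"
    using inner_hodge_laplacian[OF k \<phi> \<phi>] energy_identity[OF \<phi>] by simp
  finally show ?thesis by (simp add: algebra_simps)
qed

text \<open>The dimension is attained by some face, since the maximum is over a finite nonempty set,
  and that face has subsets of every smaller cardinality.\<close>

lemma F_nonempty:
  assumes "\<Sigma> \<noteq> {}" "-1 \<le> j" "j \<le> cdim \<Sigma>"
  shows "F j \<noteq> {}"
proof -
  have "finite \<Sigma>" using finV complex by (auto simp: abstract_complex_def intro: finite_subset)
  moreover have "{j. F j \<noteq> {}} = (\<lambda>\<sigma>. int (card \<sigma>) - 1) ` \<Sigma>" by (force simp: faces_def)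
  ultimately have "cdim \<Sigma> \<in> (\<lambda>\<sigma>. int (card \<sigma>) - 1) ` \<Sigma>"
    unfolding cdim_def using assms(1) Max_in[of "(\<lambda>\<sigma>. int (card \<sigma>) - 1) ` \<Sigma>"] by simp
  then obtain \<sigma> where \<sigma>: "\<sigma> \<in> \<Sigma>" "cdim \<Sigma> = int (card \<sigma>) - 1" by blast
  then have "nat (j + 1) \<le> card \<sigma>" using assms(3) by simp
  then obtain \<tau> where "\<tau> \<subseteq> \<sigma>" "card \<tau> = nat (j + 1)" by (rule obtain_subset_with_card_n)
  with \<sigma> assms(2) have "\<tau> \<in> F j" using face_closed by (auto simp: faces_def)
  then show ?thesis by blast
qed

end

theorem corollary6p2:
  fixes V :: "'a set" and \<Sigma> :: "'a set set"
    and \<delta>' :: "int \<Rightarrow> ('a set \<Rightarrow> real) \<Rightarrow> ('a set \<Rightarrow> real)"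
    and n d k l :: int
  assumes "finite V"
    and "abstract_complex V \<Sigma>"
    and "coboundary_operators (Pow V) \<delta>'"
    and "n = int (card V)"
    and "d = cdim \<Sigma>"
    and "d \<ge> l" and "l \<ge> k + 1" and "k + 1 \<ge> 1"
    and "n \<ge> d + 3"
    and "hodge_min \<delta>' \<Sigma> l >
      real_of_int n *
        (1 - (\<Prod>i = 0..l - k - 1. real (min_degree \<Sigma> (k + i)) / real_of_int (n - k - i - 2)))"
  shows "carrier (cohomology \<delta>' \<Sigma> k) = {\<one>\<^bsub>cohomology \<delta>' \<Sigma> k\<^esub>}"
proof -
  interpret coboundary_complex V \<Sigma> \<delta>'
    using assms(1-3) by unfold_locales
  have k: "0 \<le> k" and l: "0 \<le> l" and ln: "l + 1 < n" using assms(6-9) by auto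
  show ?thesis
  proof (rule cohomology_trivial[OF k])
    fix \<phi> assume \<phi>: "\<phi> \<in> ell2 (F k)" and harmonic: "hodge_laplacian \<delta>' \<Sigma> k \<phi> = (\<lambda>_. 0)"
    show "\<phi> = (\<lambda>_. 0)"
    \<comment> \<open>For empty \<Sigma> the dimension is a \<open>Max\<close> of the empty set and
      says nothing, but there are no faces and \<phi> is 0 by its support.\<close>
    proof (cases "\<Sigma> = {}")
      case True
      then show ?thesis using \<phi> by (auto simp: ell2_def faces_def)
    next
      case False
      define c where "c = real (card V) - hodge_min \<delta>' \<Sigma> l"
      define p where "p = (\<Prod>i = 0..l - k - 1. real (min_degree \<Sigma> (k + i)) / real_of_int (n - k - i - 2))"
      \<comment> \<open>Nonnegativity of \<open>c\<close> is read off by testing the bound in degree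
        \<open>l\<close> on one indicator, which has norm 1.\<close>
      obtain \<sigma> where \<sigma>: "\<sigma> \<in> F l" using F_nonempty[OF False, of l] l assms(5,6) by auto
      have "0 \<le> ell2_inner (N (l + 1)) (up (indicator {\<sigma>})) (up (indicator {\<sigma>}))"
        by (rule ell2_inner_ge_0)
      also have "\<dots> \<le> c * ell2_inner (F l) (indicator {\<sigma>}) (indicator {\<sigma>})"
        unfolding c_def using l \<sigma> by (intro hodge_min_bound ell2_indicator)
      finally have c0: "0 \<le> c" using \<sigma> by (simp add: ell2_inner_indicator finite_F)
      have cp: "c < real (card V) * p"
        using assms(10) by (simp add: c_def p_def assms(4) algebra_simps)
      have card: "0 < real (card V)" using ln l by (simp add: assms(4))
      \<comment> \<open>As 0 \<le> c < n p, the product is positive. Hence no factor vanishes, and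
        all minimal degrees in the descent are positive.\<close>
      have p0: "0 < p"
        using c0 cp card by (meson le_less_trans zero_less_mult_pos)
      have "down_bounded l c"
        using c0 hodge_min_bound[OF l] unfolding c_def by (intro up_bound_imp_down_bounded) auto
      moreover have "0 < min_degree \<Sigma> (k + i)" if "0 \<le> i" "i < int (nat (l - k))" for i
      proof (rule ccontr)
        assume *: "\<not> 0 < min_degree \<Sigma> (k + i)"
        have "p = 0" unfolding p_def
          by (intro prod_zero bexI[of _ i]) (use that * in \<open>auto split: if_splits\<close>)
        with p0 show False by simp
      qed
      \<comment> \<open>The descent takes l - k steps. The resulting bound c / p is below
        \<open>n\<close> precisely because of the assumed spectral gap.\<close>
      ultimately have "down_bounded k (c / p)"
        using down_bounded_descend[of k "nat (l - k)" c] ln assms(4,7) by (simp add: p_def)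
      moreover have "0 \<le> c / p" "c / p < real (card V)"
        using c0 p0 cp by (simp_all add: pos_divide_less_eq)
      ultimately show ?thesis using harmonic_zero[OF k _ _ _ \<phi> harmonic] by blast
    qed
  qed
qed

end
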